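(* Let $n$ be a positive integer, $\lambda\in\mathbb T$ and $f\in\mathcal O(\mathbb D)$. Then $f\in\mathcal H_{\lambda,n}$ if and only if $f=\alpha+(z-\lambda)g$ for some $g\in\mathcal H_{\sigma,n-1}$ and some $\alpha\in\mathbb C$. Moreover, in this case: (i) $D_{\lambda,n}(f)=D_{\sigma,n-1}(g)$; (ii) $f(z)\to\alpha$ as $z\to\lambda$ within each oricyclic approach region $\{z\in\mathbb D:|z-\lambda|<\kappa(1-|z|^2)^{1/2}\}$, $\kappa>0$. In particular $f^*(\lambda)$ exists and equals $\alpha$.
   Context: $\mathbb D$ is the open unit disc, $\mathbb T$ the unit circle, $dA$ the normalized Lebesgue area measure on $\mathbb D$, $\sigma$ the normalized arc-length measure on $\mathbb T$, $\mathcal O(\mathbb D)$ the holomorphic functions on $\mathbb D$. For a finite non-negative Borel measure $\mu$ on $\mathbb T$, $P_\mu(z)=\int_{\mathbb T}\frac{1-|z|^2}{|z-\zeta|^2}\,d\mu(\zeta)$. For $n\geq 1$ and $f\in\mathcal O(\mathbb D)$, $D_{\mu,n}(f)=\frac{1}{n!(n-1)!}\int_{\mathbb D}|f^{(n)}(z)|^2P_\mu(z)(1-|z|^2)^{n-1}dA(z)$. For $f=\sum_k a_kz^k$ and $j\ge 0$, $D_{\sigma,j}(f)=\sum_{k\geq j}\binom{k}{j}|a_k|^2$ (so $D_{\sigma,0}(f)$ is the squared Hardy norm), and $\mathcal H_{\sigma,j}=\{f\in\mathcal O(\mathbb D):D_{\sigma,j}(f)<\infty\}$ (so $\mathcal H_{\sigma,0}=H^2$).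 For $\lambda\in\mathbb T$, $D_{\lambda,n}:=D_{\delta_\lambda,n}$ where $\delta_\lambda$ is the Dirac measure at $\lambda$, and $\mathcal H_{\lambda,n}=\{f\in\mathcal O(\mathbb D):D_{\lambda,n}(f)<\infty\}$. For $f\in\mathcal O(\mathbb D)$, $f^*(\lambda):=\lim_{r\to1^-}f(r\lambda)$ when it exists. *)

theory Defs
  imports "HOL-Complex_Analysis.Complex_Analysis"
begin

definition taylor_coeff :: "(complex \<Rightarrow> complex) \<Rightarrow> nat \<Rightarrow> complex" where
  "taylor_coeff f k = (deriv ^^ k) f 0 / of_nat (fact k)"

definition D_sigma :: "nat \<Rightarrow> (complex \<Rightarrow> complex) \<Rightarrow> ennreal" where
  "D_sigma j f = (\<Sum>k. ennreal (real (k choose j) * (cmod (taylor_coeff f k))\<^sup>2))"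

definition poisson_dirac :: "complex \<Rightarrow> complex \<Rightarrow> real" where
  "poisson_dirac lam z = (1 - (cmod z)\<^sup>2) / (cmod (z - lam))\<^sup>2"

text \<open>D_{lambda,n}(f), with dA = Lebesgue measure / pi (normalized area measure on the disc).\<close>
definition D_lambda :: "complex \<Rightarrow> nat \<Rightarrow> (complex \<Rightarrow> complex) \<Rightarrow> ennreal" where
  "D_lambda lam n f =
     ennreal (1 / (fact n * fact (n - 1) * pi)) *
     (\<integral>\<^sup>+ z \<in> ball 0 1. ennreal ((cmod ((deriv ^^ n) f z))\<^sup>2 * poisson_dirac lam z
                                      * (1 - (cmod z)\<^sup>2) ^ (n - 1)) \<partial>lborel)"

end

theory Submission
  imports Defs
begin

text \<open>
  Put \<open>h = f\<^sup>(\<^sup>n\<^sup>) / (z - \<lambda>)\<close>. Since the Poisson kernel of the point mass contributes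
  \<open>(1 - \<bar>z\<bar>\<^sup>2) / \<bar>z - \<lambda>\<bar>\<^sup>2\<close>, the integral \<open>D\<^sub>\<lambda>\<^sub>,\<^sub>n f\<close> is a weighted Bergman norm of \<open>h\<close>, that is, a weighted
  \<open>\<ell>\<^sup>2\<close> sum of the Taylor coefficients of \<open>h\<close>. With \<open>f = \<alpha> + (z - \<lambda>) g\<close> and
  \<open>u k = \<lambda>\<^sup>k g\<^sub>k\<^sub>+\<^sub>n\<^sub>-\<^sub>1\<close>, summation by parts expresses these coefficients by \<open>u (k+1) - T k\<close>, where \<open>T k\<close> is the mean of
  \<open>u 0, ..., u k\<close> with the binomial weights \<open>w k\<close> that occur in \<open>D\<^sub>\<sigma>\<^sub>,\<^sub>n\<^sub>-\<^sub>1 g\<close>. The identity for the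
  variance of two weighted points then telescopes: with \<open>W k = w 0 + ... + w k\<close>, the sum of \<open>w k \<bar>u k\<bar>\<^sup>2\<close> over \<open>k \<le> K\<close> equals
  the partial sum of \<open>D\<^sub>\<lambda>\<^sub>,\<^sub>n f\<close> plus \<open>W K \<bar>T K\<bar>\<^sup>2\<close>. The last term tends to \<open>0\<close> if \<open>D\<^sub>\<sigma>\<^sub>,\<^sub>n\<^sub>-\<^sub>1 g\<close> is
  finite. If only \<open>D\<^sub>\<lambda>\<^sub>,\<^sub>n f\<close> is finite, then \<open>T\<close> converges to some \<open>L\<close> with \<open>W K \<bar>T K - L\<bar>\<^sup>2\<close> bounded, and
  the choice of \<open>\<alpha>\<close> that replaces \<open>u\<close> by \<open>u - L\<close> gives the decomposition. The boundary limits
  follow from \<open>(1 - \<bar>z\<bar>\<^sup>2) \<bar>g z\<bar>\<^sup>2 \<longlongrightarrow> 0\<close> for \<open>g\<close> in the Hardy space.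
\<close>

subsection \<open>Rotation invariance of the area measure\<close>

text \<open>Multiplication by \<open>c\<close> in real coordinates. On \<open>real^2\<close> the
  invariance of Lebesgue measure under orthogonal transformations can be applied.\<close>

definition rot2 :: "complex \<Rightarrow> real^2 \<Rightarrow> real^2" where
  "rot2 c v = vector [Re c * v$1 - Im c * v$2, Im c * v$1 + Re c * v$2]"

definition complex_of_vec2 :: "real^2 \<Rightarrow> complex" where
  "complex_of_vec2 v = Complex (v$1) (v$2)"

lemma complex_of_vec2_rot2: "complex_of_vec2 (rot2 c v) = c * complex_of_vec2 v"
  by (simp add: complex_of_vec2_def rot2_def complex_eq_iff)

lemma complex_of_vec2_inject: "complex_of_vec2 u = complex_of_vec2 v \<longleftrightarrow> u = v"
  by (simp add: complex_of_vec2_def vec_eq_iff forall_2)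

lemma norm_complex_of_vec2: "cmod (complex_of_vec2 v) = norm v"
  by (simp add: complex_of_vec2_def norm_vec_def L2_set_def sum_2 cmod_def)

lemma linear_complex_of_vec2: "linear complex_of_vec2"
  by (rule linearI) (auto simp: complex_of_vec2_def complex_eq_iff)

lemma measurable_complex_of_vec2 [measurable]: "complex_of_vec2 \<in> borel_measurable borel"
  by (intro borel_measurable_continuous_onI linear_continuous_on linear_conv_bounded_linear[THEN iffD1]
      linear_complex_of_vec2)

lemma orthogonal_transformation_rot2:
  assumes "cmod c = 1"
  shows "orthogonal_transformation (rot2 c)"
  unfolding orthogonal_transformation
proof
  show "linear (rot2 c)"
    by (rule linearI) (auto simp: rot2_def vec_eq_iff forall_2 algebra_simps)
  show "\<forall>v. norm (rot2 c v) = norm v"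
    by (simp add: norm_complex_of_vec2[symmetric] complex_of_vec2_rot2 norm_mult assms)
qed

text \<open>Lebesgue measure is determined by its values on boxes, and the preimage of a box under
  \<open>complex_of_vec2\<close> is the box with the same side lengths.\<close>

lemma lborel_complex_eq_distr: "(lborel :: complex measure) = distr lborel borel complex_of_vec2"
proof (rule lborel_eqI)
  fix l u :: complex
  assume le: "\<And>b. b \<in> Basis \<Longrightarrow> l \<bullet> b \<le> u \<bullet> b"
  have vim: "complex_of_vec2 -` box l u = box (vector [Re l, Im l]) (vector [Re u, Im u])"
    by (auto simp: complex_of_vec2_def box_def Basis_complex_def Basis_vec_def cart_eq_inner_axis[symmetric] axis_inverse forall_2
        inner_complex_def inner_axis)
  have inj: "axis 1 (1::real) \<noteq> (axis 2 1 :: real^2)" by (simp add: axis_eq_axis)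
  have "emeasure (distr lborel borel complex_of_vec2) (box l u) =
      emeasure lborel (box (vector [Re l, Im l]) (vector [Re u, Im u] :: real^2))"
    by (subst emeasure_distr) (auto simp: vim)
  also have "\<dots> = ennreal (\<Prod>b\<in>Basis. (u - l) \<bullet> b)"
    using le[of 1] le[of \<i>] inj by (subst emeasure_lborel_box)
      (auto simp: Basis_vec_def Basis_complex_def UNIV_2 inner_axis inner_complex_def mult.commute)
  finally show "emeasure (distr lborel borel complex_of_vec2) (box l u) =
     ennreal (\<Prod>b\<in>Basis. (u - l) \<bullet> b)" .
qed simp

text \<open>Carried over to \<open>real^2\<close>, the preimage becomes the image of
  \<open>B2\<close> under the inverse rotation, which is orthogonal. Boundedness gives
  \<open>B2\<close> finite measure, as the result on orthogonal images requires.\<close>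

lemma emeasure_lborel_vimage_rotation:
  assumes "cmod c = 1" and "bounded B" and [measurable]: "B \<in> sets borel"
  shows "emeasure lborel ((\<lambda>z. c * z) -` B) = emeasure lborel B"
proof -
  have [measurable]: "(\<lambda>z. c * z) \<in> borel_measurable borel"
    by (intro borel_measurable_continuous_onI continuous_intros)
  have vimB[measurable]: "(\<lambda>z. c * z) -` B \<in> sets borel"
    by (rule measurable_sets_borel[OF _ assms(3)]) measurable
  have vimT[measurable]: "complex_of_vec2 -` S \<in> sets borel" if "S \<in> sets borel" for S
    using measurable_complex_of_vec2 that by (rule measurable_sets_borel)
  define B2 where "B2 = complex_of_vec2 -` B"
  have B2[measurable]: "B2 \<in> sets borel"
    unfolding B2_def using assms(3) by (rule vimT)
  have "bounded B2"
    using \<open>bounded B\<close> unfolding bounded_iff B2_def by (auto simp: norm_complex_of_vec2[symmetric])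
  then have lm: "B2 \<in> lmeasurable"
    using B2 by (intro bounded_set_imp_lmeasurable) auto
  have c: "c * cnj c = 1"
    using assms(1) by (simp add: complex_norm_square[symmetric])
  have vim: "complex_of_vec2 -` ((\<lambda>z. c * z) -` B) = rot2 (cnj c) ` B2"
  proof (intro set_eqI iffI)
    fix v assume "v \<in> complex_of_vec2 -` ((\<lambda>z. c * z) -` B)"
    then have "rot2 c v \<in> B2" by (simp add: B2_def complex_of_vec2_rot2)
    moreover have "v = rot2 (cnj c) (rot2 c v)"
      using c by (simp add: complex_of_vec2_inject[symmetric] complex_of_vec2_rot2 mult.assoc[symmetric] mult.commute)
    ultimately show "v \<in> rot2 (cnj c) ` B2" by blast
  next
    fix v assume "v \<in> rot2 (cnj c) ` B2"
    then show "v \<in> complex_of_vec2 -` ((\<lambda>z. c * z) -` B)"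
      using c by (auto simp: B2_def complex_of_vec2_rot2 mult.assoc[symmetric])
  qed
  have orth: "orthogonal_transformation (rot2 (cnj c))"
    using assms by (intro orthogonal_transformation_rot2) auto
  have "emeasure lborel ((\<lambda>z. c * z) -` B) = emeasure lborel (rot2 (cnj c) ` B2)"
    unfolding vim[symmetric]
    by (subst lborel_complex_eq_distr, subst emeasure_distr) (simp_all add: vimB)
  also have "\<dots> = emeasure lebesgue (rot2 (cnj c) ` B2)"
    using vimT[OF vimB] unfolding vim by simp
  also have "\<dots> = emeasure lebesgue B2"
    using measurable_orthogonal_image[OF orth lm] measure_orthogonal_image[OF orth lm] lm
    by (simp add: emeasure_eq_measure2 fmeasurableD fmeasurableD2 emeasure_eq_ennreal_measure)
  also have "\<dots> = emeasure lborel B2"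
    by simp
  also have "\<dots> = emeasure lborel B"
    unfolding B2_def by (subst lborel_complex_eq_distr, subst emeasure_distr) auto
  finally show ?thesis .
qed

text \<open>Boxes are bounded, so the invariance for bounded sets already identifies the two
  measures.\<close>

lemma lborel_rotation:
  assumes "cmod c = 1"
  shows "(lborel :: complex measure) = distr lborel borel (\<lambda>z. c * z)"
proof (rule lborel_eqI)
  fix l u :: complex
  assume le: "\<And>b. b \<in> Basis \<Longrightarrow> l \<bullet> b \<le> u \<bullet> b"
  show "emeasure (distr lborel borel (\<lambda>z. c * z)) (box l u) = ennreal (\<Prod>b\<in>Basis. (u - l) \<bullet> b)"
    using le by (subst emeasure_distr) (auto simp: emeasure_lborel_vimage_rotation[OF assms])
qed simp

text \<open>Rotation preserves both the area measure and \<open>w (cmod z)\<close>; for a suitable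
  angle the integral equals its own negative.\<close>

lemma monomials_orthogonal:
  fixes w :: "real \<Rightarrow> real"
  assumes "k \<noteq> l"
  shows "(\<integral>z. z ^ k * cnj z ^ l * of_real (w (cmod z)) \<partial>lborel) = 0" (is "?I = 0")
proof (cases "integrable lborel (\<lambda>z. z ^ k * cnj z ^ l * of_real (w (cmod z)))")
  case True
  \<comment> \<open>The rotation by this angle multiplies the integrand by \<open>-1\<close>.\<close>
  define a :: real where "a = pi / (real k - real l)"
  have a: "cis (real k * a) * cis (- (real l * a)) = -1"
    using assms by (simp add: cis_mult a_def diff_divide_distrib[symmetric] left_diff_distrib[symmetric] cis_pi)
  have [measurable]: "(\<lambda>z. z ^ k * cnj z ^ l * of_real (w (cmod z))) \<in> borel_measurable borel"
    using True by auto
  have "?I = (\<integral>z. z ^ k * cnj z ^ l * of_real (w (cmod z)) \<partial>distr lborel borel (\<lambda>z. cis a * z))"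
    using lborel_rotation[of "cis a"] by simp
  also have "\<dots> = (\<integral>z. (cis a * z) ^ k * cnj (cis a * z) ^ l * of_real (w (cmod (cis a * z))) \<partial>lborel)"
    by (subst integral_distr) auto
  also have "\<dots> = (\<integral>z. - (z ^ k * cnj z ^ l * of_real (w (cmod z))) \<partial>lborel)"
  proof (rule Bochner_Integration.integral_cong)
    fix z
    have "(cis a * z) ^ k * cnj (cis a * z) ^ l = (cis (real k * a) * cis (- (real l * a))) * (z ^ k * cnj z ^ l)"
      by (simp add: power_mult_distrib Complex.DeMoivre cis_cnj algebra_simps)
    then show "(cis a * z) ^ k * cnj (cis a * z) ^ l * of_real (w (cmod (cis a * z))) = - (z ^ k * cnj z ^ l * of_real (w (cmod z)))"
      unfolding a by (simp add: norm_mult)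
  qed simp
  also have "\<dots> = - ?I" by simp
  finally show ?thesis by simp
next
  \<comment> \<open>The Bochner integral of a non-integrable function is \<open>0\<close> by
    convention.\<close>
  case False
  then show ?thesis by (rule not_integrable_integral_eq)
qed

subsection \<open>Radial moments\<close>

text \<open>The Beta integral at integer arguments. One factor \<open>1 - t\<close> is expanded,
  which reduces the exponent \<open>n\<close> by one at the cost of raising
  \<open>k\<close>.\<close>

lemma integral_power_mult_one_minus_power:
  "((\<lambda>t::real. t ^ k * (1 - t) ^ n) has_integral (fact k * fact n / fact (k + n + 1))) {0..1}"
proof (induction n arbitrary: k)
  case 0
  have "((\<lambda>t::real. t ^ k) has_integral (1 ^ Suc k / real (Suc k) - 0 ^ Suc k / real (Suc k))) {0..1}"
    by (rule fundamental_theorem_of_calculus)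
       (auto intro!: derivative_eq_intros simp flip: has_real_derivative_iff_has_vector_derivative simp del: power_Suc of_nat_Suc)
  then show ?case by (simp add: divide_simps)
next
  case (Suc n)
  have "((\<lambda>t::real. t ^ k * (1 - t) ^ n - t ^ Suc k * (1 - t) ^ n) has_integral
      (fact k * fact n / fact (k + n + 1) - fact (Suc k) * fact n / fact (Suc k + n + 1))) {0..1}"
    by (intro has_integral_diff Suc.IH)
  moreover have "(\<lambda>t::real. t ^ k * (1 - t) ^ n - t ^ Suc k * (1 - t) ^ n) = (\<lambda>t. t ^ k * (1 - t) ^ Suc n)"
    by (auto simp: algebra_simps)
  moreover have "(fact k * fact n / fact (k + n + 1) - fact (Suc k) * fact n / fact (Suc k + n + 1) :: real)
      = fact k * fact (Suc n) / fact (k + Suc n + 1)"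
  proof -
    have "fact (Suc k + n + 1) = (real (k + n + 2)) * fact (k + n + 1)" by simp
    then show ?thesis by (simp add: divide_simps) (simp add: algebra_simps)
  qed
  ultimately show ?case by simp
qed

lemma emeasure_lborel_ball_complex:
  "r \<ge> 0 \<Longrightarrow> emeasure lborel (ball (c::complex) r) = ennreal (pi * r\<^sup>2)"
  by (subst emeasure_ball) (simp_all add: unit_ball_vol_2)

text \<open>This replaces integration in polar coordinates.\<close>

lemma distr_cmod_square:
  "distr (restrict_space lborel (ball (0::complex) 1)) borel (\<lambda>z. (cmod z)\<^sup>2) =
   density lborel (\<lambda>t. ennreal pi * indicator {0..1} t)" (is "?M = ?N")
proof (rule measure_eqI_lessThan)
  fix x :: real
  have [measurable]: "(\<lambda>z. (cmod z)\<^sup>2) \<in> borel_measurable (restrict_space lborel (ball (0::complex) 1))"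
    by (intro measurable_restrict_space1) auto
  have "?M {x<..} = emeasure lborel {z \<in> ball (0::complex) 1. x < (cmod z)\<^sup>2}"
    by (subst emeasure_distr, simp, simp, subst emeasure_restrict_space)
       (auto simp: space_restrict_space intro!: arg_cong[where f="emeasure lborel"])
  also have "\<dots> = ennreal pi * emeasure lborel ({x<..} \<inter> {0..1})"
  proof -
    \<comment> \<open>The set is the whole disc, the annulus between the radii \<open>sqrt x\<close>
      and \<open>1\<close>, or empty.\<close>
    consider "x < 0" | "0 \<le> x" "x < 1" | "x \<ge> 1" by linarith
    then show ?thesis
    proof cases
      case 1
      have "{z \<in> ball (0::complex) 1. x < (cmod z)\<^sup>2} = ball 0 1"
        using 1 by (auto intro: less_le_trans)
      moreover have "{x<..} \<inter> {0..1} = {0..1}" using 1 by auto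
      ultimately show ?thesis by (simp add: emeasure_lborel_ball_complex)
    next
      case 2
      have "{z \<in> ball (0::complex) 1. x < (cmod z)\<^sup>2} = ball 0 1 - cball 0 (sqrt x)"
      proof -
        have "x < (cmod z)\<^sup>2 \<longleftrightarrow> sqrt x < cmod z" for z
          using real_sqrt_less_iff[of x "(cmod z)\<^sup>2"] by simp
        then show ?thesis by (simp add: set_eq_iff not_le)
      qed
      moreover have "emeasure lborel (ball 0 1 - cball (0::complex) (sqrt x)) =
          emeasure lborel (ball (0::complex) 1) - emeasure lborel (cball (0::complex) (sqrt x))"
      proof (rule emeasure_Diff)
        have "sqrt x < 1" using 2 by simp
        then show "cball 0 (sqrt x) \<subseteq> ball (0::complex) 1" by (simp add: cball_subset_ball_iff)
      qed (use 2 in \<open>simp_all add: emeasure_cball\<close>)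
      moreover have "emeasure lborel (cball (0::complex) (sqrt x)) = ennreal (pi * x)"
        using 2 by (subst emeasure_cball) (simp_all add: unit_ball_vol_2)
      moreover have "{x<..} \<inter> {0..1} = {x<..1}" using 2 by auto
      ultimately show ?thesis using 2
        by (simp add: emeasure_lborel_ball_complex ennreal_minus ennreal_mult'[symmetric] right_diff_distrib)
    next
      case 3
      have "(cmod z)\<^sup>2 < 1" if "cmod z < 1" for z
        using that by (simp add: power_less_one_iff abs_square_less_1)
      then have "{z \<in> ball (0::complex) 1. x < (cmod z)\<^sup>2} = {}" using 3 by force
      moreover have "{x<..} \<inter> {0..1} = {}" using 3 by auto
      ultimately show ?thesis by (simp only:) simp
    qed
  qed
  also have "\<dots> = ?N {x<..}"
    by (subst emeasure_density)
       (simp_all add: nn_integral_cmult mult.assoc indicator_inter_arith[symmetric] Int_commute)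
  finally show eq: "?M {x<..} = ?N {x<..}" .
  have "?M {x<..} \<le> emeasure lborel (ball (0::complex) 1)"
    by (subst emeasure_distr, simp, simp, subst emeasure_restrict_space)
       (auto simp: space_restrict_space intro!: emeasure_mono)
  also have "\<dots> < \<infinity>" by (simp add: emeasure_lborel_ball_complex)
  finally show "?M {x<..} < \<infinity>" .
qed auto

text \<open>The substitution \<open>t = (cmod z)\<^sup>2\<close> turns the moment into a Beta
  integral.\<close>

lemma nn_integral_disc_moment:
  "(\<integral>\<^sup>+ z \<in> ball (0::complex) 1. ennreal ((cmod z) ^ (2 * k) * (1 - (cmod z)\<^sup>2) ^ n) \<partial>lborel) =
   ennreal (pi * fact k * fact n / fact (k + n + 1))"
proof -
  have [measurable]: "(\<lambda>z. (cmod z)\<^sup>2) \<in> borel_measurable (restrict_space lborel (ball (0::complex) 1))"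
    by (intro measurable_restrict_space1) auto
  have "(\<integral>\<^sup>+ z \<in> ball (0::complex) 1. ennreal ((cmod z) ^ (2 * k) * (1 - (cmod z)\<^sup>2) ^ n) \<partial>lborel)
      = (\<integral>\<^sup>+ z. ennreal (((cmod z)\<^sup>2) ^ k * (1 - (cmod z)\<^sup>2) ^ n) \<partial>restrict_space lborel (ball (0::complex) 1))"
    by (subst nn_integral_restrict_space) (auto simp: power_mult)
  also have "\<dots> = (\<integral>\<^sup>+ t. ennreal (t ^ k * (1 - t) ^ n) \<partial>density lborel (\<lambda>t. ennreal pi * indicator {0..1} t))"
    by (subst distr_cmod_square[symmetric], subst nn_integral_distr) auto
  also have "\<dots> = (\<integral>\<^sup>+ t. ennreal pi * (ennreal (t ^ k * (1 - t) ^ n) * indicator {0..1} t) \<partial>lborel)"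
    by (subst nn_integral_density) (auto simp: algebra_simps)
  also have "\<dots> = ennreal pi * (\<integral>\<^sup>+ t \<in> {0..1}. ennreal (t ^ k * (1 - t) ^ n) \<partial>lborel)"
    by (rule nn_integral_cmult) auto
  also have "(\<integral>\<^sup>+ t \<in> {0..1}. ennreal (t ^ k * (1 - t) ^ n) \<partial>lborel) = ennreal (fact k * fact n / fact (k + n + 1))"
    using nn_integral_has_integral_lebesgue'[OF _ integral_power_mult_one_minus_power[of k n]] by auto
  finally show ?thesis
    by (simp add: ennreal_mult[symmetric] mult.assoc del: fact_Suc)
qed

subsection \<open>Weighted Bergman norms of power series\<close>

lemma holomorphic_taylor_sums:
  assumes "h holomorphic_on ball 0 1" "z \<in> ball 0 1"
  shows "(\<lambda>k. taylor_coeff h k * z ^ k) sums h z"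
  using holomorphic_power_series[OF assms] by (simp add: taylor_coeff_def)

text \<open>Convergence of the power series at a radius strictly between \<open>r\<close> and
  \<open>1\<close> implies absolute convergence at \<open>r\<close>.\<close>

lemma summable_norm_taylor:
  assumes "h holomorphic_on ball 0 1" "0 \<le> r" "r < 1"
  shows "summable (\<lambda>k. cmod (taylor_coeff h k) * r ^ k)"
proof -
  obtain s where s: "r < s" "s < 1" using dense assms(3) by blast
  have "summable (\<lambda>k. taylor_coeff h k * complex_of_real s ^ k)"
    using s assms by (intro sums_summable[OF holomorphic_taylor_sums]) auto
  then have "summable (\<lambda>k. cmod (taylor_coeff h k * complex_of_real r ^ k))"
    using s assms by (intro powser_insidea) auto
  then show ?thesis
    using assms by (simp add: norm_mult norm_power)
qed

text \<open>Parseval for polynomials and a radial weight: the squared modulus is expanded into a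
  double sum whose off-diagonal terms vanish by \<open>monomials_orthogonal\<close>.\<close>

lemma integral_norm_square_partial_sum:
  fixes w :: "real \<Rightarrow> real"
  assumes int: "\<And>k l. integrable lborel (\<lambda>z. z ^ k * cnj z ^ l * of_real (w (cmod z)))"
  shows "(\<integral>z. (cmod (\<Sum>k<N. a k * z ^ k))\<^sup>2 * w (cmod z) \<partial>lborel) =
     (\<Sum>k<N. (cmod (a k))\<^sup>2 * (\<integral>z. (cmod z) ^ (2 * k) * w (cmod z) \<partial>lborel))"
proof -
  have eq: "complex_of_real ((cmod (\<Sum>k<N. a k * z ^ k))\<^sup>2 * w (cmod z)) =
      (\<Sum>k<N. \<Sum>l<N. a k * cnj (a l) * (z ^ k * cnj z ^ l * of_real (w (cmod z))))" for z
  proof -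
    have "complex_of_real ((cmod (\<Sum>k<N. a k * z ^ k))\<^sup>2) = (\<Sum>k<N. a k * z ^ k) * cnj (\<Sum>k<N. a k * z ^ k)"
      by (rule complex_norm_square)
    also have "\<dots> = (\<Sum>k<N. \<Sum>l<N. a k * z ^ k * (cnj (a l) * cnj z ^ l))"
      by (simp add: cnj_sum sum_product)
    finally show ?thesis
      unfolding of_real_mult by (simp only: sum_distrib_left mult_ac)
  qed
  have diag: "(\<integral>z. z ^ k * cnj z ^ k * of_real (w (cmod z)) \<partial>lborel) =
      complex_of_real (\<integral>z. (cmod z) ^ (2 * k) * w (cmod z) \<partial>lborel)" for k
  proof -
    have "z ^ k * cnj z ^ k = complex_of_real ((cmod z) ^ (2 * k))" for z
      by (simp only: power_mult_distrib[symmetric] complex_norm_square[symmetric] power_mult of_real_power)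
    then show ?thesis
      by (subst integral_complex_of_real[symmetric]) simp
  qed
  have "complex_of_real (\<integral>z. (cmod (\<Sum>k<N. a k * z ^ k))\<^sup>2 * w (cmod z) \<partial>lborel) =
      (\<integral>z. (\<Sum>k<N. \<Sum>l<N. a k * cnj (a l) * (z ^ k * cnj z ^ l * of_real (w (cmod z)))) \<partial>lborel)"
    unfolding eq[symmetric] by (rule integral_complex_of_real[symmetric])
  also have "\<dots> = (\<Sum>k<N. \<Sum>l<N. a k * cnj (a l) * (\<integral>z. z ^ k * cnj z ^ l * of_real (w (cmod z)) \<partial>lborel))"
    by (subst Bochner_Integration.integral_sum, intro Bochner_Integration.integrable_sum integrable_mult_right int,
        subst Bochner_Integration.integral_sum, intro integrable_mult_right int, simp only: integral_mult_right_zero)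
  also have "\<dots> = (\<Sum>k<N. \<Sum>l<N. if l = k then a k * cnj (a k) * complex_of_real (\<integral>z. (cmod z) ^ (2 * k) * w (cmod z) \<partial>lborel) else 0)"
    by (intro sum.cong refl) (use monomials_orthogonal diag in auto)
  also have "\<dots> = complex_of_real (\<Sum>k<N. (cmod (a k))\<^sup>2 * (\<integral>z. (cmod z) ^ (2 * k) * w (cmod z) \<partial>lborel))"
    by (simp add: complex_norm_square[symmetric] del: of_real_power)
  finally show "(\<integral>z. (cmod (\<Sum>k<N. a k * z ^ k))\<^sup>2 * w (cmod z) \<partial>lborel) =
     (\<Sum>k<N. (cmod (a k))\<^sup>2 * (\<integral>z. (cmod z) ^ (2 * k) * w (cmod z) \<partial>lborel))"
    by (simp only: of_real_eq_iff)
qed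

text \<open>On a disc of radius \<open>r < 1\<close> all partial sums of the power series are
  bounded by one constant, so dominated convergence extends Parseval from polynomials to
  \<open>h\<close>.\<close>

lemma nn_integral_smaller_disc_norm_square:
  assumes hol: "h holomorphic_on ball 0 1" and r: "0 < r" "r < 1"
  shows "(\<integral>\<^sup>+ z \<in> ball 0 r. ennreal ((cmod (h z))\<^sup>2 * (1 - (cmod z)\<^sup>2) ^ n) \<partial>lborel) =
    (\<Sum>k. ennreal ((cmod (taylor_coeff h k))\<^sup>2) *
       (\<integral>\<^sup>+ z \<in> ball (0::complex) r. ennreal ((cmod z) ^ (2 * k) * (1 - (cmod z)\<^sup>2) ^ n) \<partial>lborel))"
proof -
  define a where "a = taylor_coeff h"
  \<comment> \<open>The indicator is built into the radial weight, so that integrals over the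
    smaller disc become integrals over the plane.\<close>
  define w where "w = (\<lambda>t. (1 - t\<^sup>2) ^ n * indicator {..<r} t :: real)"
  have [measurable]: "w \<in> borel_measurable borel" unfolding w_def by measurable
  have w0: "w (cmod z) = 0" if "z \<notin> ball 0 r" for z
    using that by (simp add: w_def)
  have w1: "0 \<le> w (cmod z)" "w (cmod z) \<le> 1" for z
  proof -
    have "0 \<le> 1 - (cmod z)\<^sup>2" "1 - (cmod z)\<^sup>2 \<le> 1" if "cmod z < r"
      using that r by (auto simp: abs_square_le_1)
    then show "0 \<le> w (cmod z)" "w (cmod z) \<le> 1" by (auto simp: w_def power_le_one indicator_def)
  qed
  have dom: "integrable lborel (\<lambda>z. C * indicator (ball (0::complex) r) z :: real)" for C
    by (intro integrable_mult_right integrable_real_indicator)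
       (use r in \<open>simp_all add: emeasure_lborel_ball_complex\<close>)
  have pow1: "cmod z ^ k \<le> 1" if "z \<in> ball 0 r" for z k
    using that r by (intro power_le_one) auto
  have int: "integrable lborel (\<lambda>z. z ^ k * cnj z ^ l * of_real (w (cmod z)))" for k l
  proof (rule Bochner_Integration.integrable_bound[OF dom[of 1]])
    show "AE z in lborel. norm (z ^ k * cnj z ^ l * of_real (w (cmod z))) \<le> norm (1 * indicator (ball (0::complex) r) z :: real)"
    proof (rule AE_I2)
      fix z show "norm (z ^ k * cnj z ^ l * of_real (w (cmod z))) \<le> norm (1 * indicator (ball (0::complex) r) z :: real)"
      proof (cases "z \<in> ball 0 r")
        case True
        then show ?thesis
          using pow1[OF True] w1[of z]
          by (simp add: norm_mult norm_power mult_le_one)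
      next
        case False
        then show ?thesis using w0 by simp
      qed
    qed
    have "(\<lambda>z::complex. z ^ k * cnj z ^ l) \<in> borel_measurable borel"
      by (intro borel_measurable_continuous_onI continuous_intros)
    then show "(\<lambda>z. z ^ k * cnj z ^ l * of_real (w (cmod z))) \<in> borel_measurable lborel"
      by measurable
  qed
  have intm: "integrable lborel (\<lambda>z::complex. (cmod z) ^ (2 * k) * w (cmod z))" for k
  proof -
    have "(\<lambda>z::complex. cmod (z ^ k * cnj z ^ k * of_real (w (cmod z)))) = (\<lambda>z. (cmod z) ^ (2 * k) * w (cmod z))"
      using w1 by (auto simp: norm_mult norm_power power_add mult_2)
    then show ?thesis using integrable_norm[OF int[of k k]] by simp
  qed
  define B where "B = (\<Sum>k. cmod (a k) * r ^ k)"
  have sB: "summable (\<lambda>k. cmod (a k) * r ^ k)"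
    unfolding a_def using r by (intro summable_norm_taylor[OF hol]) auto
  have bound: "cmod (\<Sum>k<N. a k * z ^ k) \<le> B" if "z \<in> ball 0 r" for z N
  proof -
    have "cmod (\<Sum>k<N. a k * z ^ k) \<le> (\<Sum>k<N. cmod (a k * z ^ k))" by (rule norm_sum)
    also have "\<dots> \<le> (\<Sum>k<N. cmod (a k) * r ^ k)"
      using that by (intro sum_mono) (auto simp: norm_mult norm_power intro!: mult_left_mono power_mono)
    also have "\<dots> \<le> B"
      unfolding B_def using r by (intro sum_le_suminf sB) auto
    finally show ?thesis .
  qed
  define g where "g z = (if z \<in> ball 0 r then h z else 0)" for z
  have lim: "(\<lambda>N. (cmod (\<Sum>k<N. a k * z ^ k))\<^sup>2 * w (cmod z)) \<longlonglongrightarrow> (cmod (g z))\<^sup>2 * w (cmod z)" for z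
  proof (cases "z \<in> ball 0 r")
    case True
    then have "(\<lambda>N. \<Sum>k<N. a k * z ^ k) \<longlonglongrightarrow> h z"
      using holomorphic_taylor_sums[OF hol, of z] r unfolding a_def sums_def by auto
    then show ?thesis using True by (auto simp: g_def intro!: tendsto_intros)
  next
    case False
    then show ?thesis using w0 by simp
  qed
  have [measurable]: "(\<lambda>z. \<Sum>k<N. a k * z ^ k) \<in> borel_measurable borel" for N
    by (intro borel_measurable_continuous_onI continuous_intros)
  have gm [measurable]: "(\<lambda>z. (cmod (g z))\<^sup>2 * w (cmod z)) \<in> borel_measurable lborel"
    by (rule borel_measurable_LIMSEQ_metric[OF _ lim]) measurable
  have AEb: "AE z in lborel. norm ((cmod (\<Sum>k<N. a k * z ^ k))\<^sup>2 * w (cmod z)) \<le> B\<^sup>2 * indicator (ball 0 r) z" for N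
  proof (rule AE_I2)
    fix z
    show "norm ((cmod (\<Sum>k<N. a k * z ^ k))\<^sup>2 * w (cmod z)) \<le> B\<^sup>2 * indicator (ball 0 r) z"
    proof (cases "z \<in> ball 0 r")
      case True
      have "(cmod (\<Sum>k<N. a k * z ^ k))\<^sup>2 * w (cmod z) \<le> B\<^sup>2 * 1"
        using bound[OF True] w1[of z] by (intro mult_mono power_mono) auto
      then show ?thesis using True w1[of z] by simp
    next
      case False
      then show ?thesis using w0 by simp
    qed
  qed
  have pm: "(\<lambda>z. (cmod (\<Sum>k<N. a k * z ^ k))\<^sup>2 * w (cmod z)) \<in> borel_measurable lborel" for N
    by measurable
  have gi: "integrable lborel (\<lambda>z. (cmod (g z))\<^sup>2 * w (cmod z))"
    using integrable_dominated_convergence[OF gm pm dom AE_I2[OF lim] AEb] .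
  have glim: "(\<lambda>N. \<integral>z. (cmod (\<Sum>k<N. a k * z ^ k))\<^sup>2 * w (cmod z) \<partial>lborel)
       \<longlonglongrightarrow> (\<integral>z. (cmod (g z))\<^sup>2 * w (cmod z) \<partial>lborel)"
    using integral_dominated_convergence[OF gm pm dom AE_I2[OF lim] AEb] .
  define m where "m k = (\<integral>z. (cmod z) ^ (2 * k) * w (cmod z) \<partial>lborel)" for k
  have m0: "0 \<le> m k" for k
    unfolding m_def using w1 by (intro integral_nonneg_AE AE_I2) auto
  have sums: "(\<lambda>k. (cmod (a k))\<^sup>2 * m k) sums (\<integral>z. (cmod (g z))\<^sup>2 * w (cmod z) \<partial>lborel)"
    using glim unfolding sums_def integral_norm_square_partial_sum[OF int] m_def .
  have mk: "ennreal (m k) = (\<integral>\<^sup>+ z \<in> ball (0::complex) r. ennreal ((cmod z) ^ (2 * k) * (1 - (cmod z)\<^sup>2) ^ n) \<partial>lborel)" for k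
  proof -
    have "ennreal (m k) = (\<integral>\<^sup>+ z. ennreal ((cmod z) ^ (2 * k) * w (cmod z)) \<partial>lborel)"
      unfolding m_def using w1 by (intro nn_integral_eq_integral[symmetric] intm AE_I2) auto
    also have "\<dots> = (\<integral>\<^sup>+ z \<in> ball (0::complex) r. ennreal ((cmod z) ^ (2 * k) * (1 - (cmod z)\<^sup>2) ^ n) \<partial>lborel)"
      by (intro nn_integral_cong) (auto simp: w_def indicator_def)
    finally show ?thesis .
  qed
  have "(\<integral>\<^sup>+ z \<in> ball 0 r. ennreal ((cmod (h z))\<^sup>2 * (1 - (cmod z)\<^sup>2) ^ n) \<partial>lborel) =
      (\<integral>\<^sup>+ z. ennreal ((cmod (g z))\<^sup>2 * w (cmod z)) \<partial>lborel)"
    by (intro nn_integral_cong) (auto simp: g_def w_def indicator_def)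
  also have "\<dots> = ennreal (\<integral>z. (cmod (g z))\<^sup>2 * w (cmod z) \<partial>lborel)"
    using w1 by (intro nn_integral_eq_integral gi AE_I2) auto
  also have "\<dots> = (\<Sum>k. ennreal ((cmod (a k))\<^sup>2 * m k))"
    using sums m0 by (intro suminf_ennreal_eq[symmetric]) auto
  also have "\<dots> = (\<Sum>k. ennreal ((cmod (a k))\<^sup>2) * ennreal (m k))"
    using m0 by (simp add: ennreal_mult)
  also have "\<dots> = (\<Sum>k. ennreal ((cmod (a k))\<^sup>2) *
       (\<integral>\<^sup>+ z \<in> ball (0::complex) r. ennreal ((cmod z) ^ (2 * k) * (1 - (cmod z)\<^sup>2) ^ n) \<partial>lborel))"
    unfolding mk ..
  finally show ?thesis unfolding a_def .
qed

text \<open>Monotone convergence along radii increasing to \<open>1\<close>; the summand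
  \<open>2\<close> makes the first radius positive.\<close>

lemma nn_integral_ball_SUP:
  fixes F :: "complex \<Rightarrow> ennreal"
  assumes "\<And>m. (\<lambda>z. F z * indicator (ball 0 (1 - 1 / (real m + 2))) z) \<in> borel_measurable lborel"
  shows "(\<integral>\<^sup>+ z \<in> ball 0 1. F z \<partial>lborel) = (SUP m. \<integral>\<^sup>+ z \<in> ball 0 (1 - 1 / (real m + 2)). F z \<partial>lborel)"
proof -
  have mono: "1 - 1 / (real m + 2) \<le> 1 - 1 / (real m' + 2)" if "m \<le> m'" for m m'
    using that by (auto simp: frac_le)
  have ex: "\<exists>m. cmod z < 1 - 1 / (real m + 2)" if z: "cmod z < 1" for z
  proof -
    obtain m where "inverse (real (Suc m)) < 1 - cmod z" using reals_Archimedean[of "1 - cmod z"] z by (auto simp del: of_nat_Suc)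
    moreover have "1 / (real m + 2) \<le> inverse (real (Suc m))" by (auto simp: inverse_eq_divide frac_le)
    ultimately have "cmod z < 1 - 1 / (real m + 2)" by linarith
    then show ?thesis by blast
  qed
  have "F z * indicator (ball 0 1) z = (SUP m. F z * indicator (ball 0 (1 - 1 / (real m + 2))) z)" for z
  proof (cases "cmod z < 1")
    case True
    then obtain m where "cmod z < 1 - 1 / (real m + 2)" using ex by blast
    then have "F z \<le> (SUP m. F z * indicator (ball 0 (1 - 1 / (real m + 2))) z)"
      by (intro SUP_upper2[of m]) auto
    moreover have "(SUP m. F z * indicator (ball 0 (1 - 1 / (real m + 2))) z) \<le> F z"
      by (intro SUP_least) (auto simp: indicator_def)
    ultimately show ?thesis using True by (auto intro: antisym)
  next
    case False
    then have "\<not> cmod z < 1 - 1 / (real m + 2)" for m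
      by (smt (verit) of_nat_0_le_iff divide_nonneg_nonneg)
    then show ?thesis using False by simp
  qed
  then have "(\<integral>\<^sup>+ z \<in> ball 0 1. F z \<partial>lborel) = (\<integral>\<^sup>+ z. (SUP m. F z * indicator (ball 0 (1 - 1 / (real m + 2))) z) \<partial>lborel)"
    by (intro nn_integral_cong) simp
  also have "\<dots> = (SUP m. \<integral>\<^sup>+ z \<in> ball 0 (1 - 1 / (real m + 2)). F z \<partial>lborel)"
  proof (rule nn_integral_monotone_convergence_SUP[OF _ assms])
    show "incseq (\<lambda>m z. F z * indicator (ball 0 (1 - 1 / (real m + 2))) z)"
    proof (rule incseq_SucI le_funI)+
      fix m z
      show "F z * indicator (ball 0 (1 - 1 / (real m + 2))) z \<le> F z * indicator (ball 0 (1 - 1 / (real (Suc m) + 2))) z"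
        using mono[of m "Suc m"] by (intro mult_left_mono) (auto simp: indicator_def)
    qed
  qed
  finally show ?thesis .
qed

text \<open>Parseval for the weighted Bergman norm, with both sides possibly infinite. As the radius
  grows to \<open>1\<close>, the integrals and every term of the series increase, so supremum and
  sum may be exchanged.\<close>

lemma nn_integral_disc_norm_square:
  assumes hol: "h holomorphic_on ball 0 1"
  shows "(\<integral>\<^sup>+ z \<in> ball 0 1. ennreal ((cmod (h z))\<^sup>2 * (1 - (cmod z)\<^sup>2) ^ n) \<partial>lborel) =
    (\<Sum>k. ennreal (pi * fact k * fact n / fact (k + n + 1) * (cmod (taylor_coeff h k))\<^sup>2))"
proof -
  define r where "r m = 1 - 1 / (real m + 2)" for m
  have r: "0 < r m" "r m < 1" for m by (auto simp: r_def field_simps)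
  define M where "M k m = (\<integral>\<^sup>+ z \<in> ball (0::complex) (r m). ennreal ((cmod z) ^ (2 * k) * (1 - (cmod z)\<^sup>2) ^ n) \<partial>lborel)" for k m
  have hm: "(\<lambda>z. ennreal ((cmod (h z))\<^sup>2 * (1 - (cmod z)\<^sup>2) ^ n) * indicator (ball 0 (r m)) z) \<in> borel_measurable lborel" for m
  proof -
    have "continuous_on (ball 0 (r m)) (\<lambda>z. (cmod (h z))\<^sup>2 * (1 - (cmod z)\<^sup>2) ^ n)"
      using r[of m] by (intro continuous_intros holomorphic_on_imp_continuous_on holomorphic_on_subset[OF hol]) auto
    then have "(\<lambda>z. indicator (ball 0 (r m)) z *\<^sub>R ((cmod (h z))\<^sup>2 * (1 - (cmod z)\<^sup>2) ^ n)) \<in> borel_measurable borel"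
      by (intro borel_measurable_continuous_on_indicator) auto
    then have "(\<lambda>z. ennreal (indicator (ball 0 (r m)) z *\<^sub>R ((cmod (h z))\<^sup>2 * (1 - (cmod z)\<^sup>2) ^ n))) \<in> borel_measurable lborel"
      by simp
    also have "(\<lambda>z. ennreal (indicator (ball 0 (r m)) z *\<^sub>R ((cmod (h z))\<^sup>2 * (1 - (cmod z)\<^sup>2) ^ n))) =
        (\<lambda>z. ennreal ((cmod (h z))\<^sup>2 * (1 - (cmod z)\<^sup>2) ^ n) * indicator (ball 0 (r m)) z)"
      by (auto simp: indicator_def)
    finally show ?thesis .
  qed
  have inc: "incseq (M k)" for k
  proof (rule incseq_SucI)
    fix m
    have "r m \<le> r (Suc m)" by (auto simp: r_def frac_le)
    then show "M k m \<le> M k (Suc m)"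
      unfolding M_def by (intro nn_integral_mono mult_left_mono) (auto simp: indicator_def)
  qed
  have M: "(SUP m. M k m) = ennreal (pi * fact k * fact n / fact (k + n + 1))" for k
    unfolding M_def r_def nn_integral_disc_moment[symmetric]
    by (rule nn_integral_ball_SUP[symmetric]) (intro borel_measurable_times_ennreal borel_measurable_indicator, measurable)
  have "(\<integral>\<^sup>+ z \<in> ball 0 1. ennreal ((cmod (h z))\<^sup>2 * (1 - (cmod z)\<^sup>2) ^ n) \<partial>lborel) =
      (SUP m. \<integral>\<^sup>+ z \<in> ball 0 (r m). ennreal ((cmod (h z))\<^sup>2 * (1 - (cmod z)\<^sup>2) ^ n) \<partial>lborel)"
    using hm unfolding r_def by (rule nn_integral_ball_SUP)
  also have "\<dots> = (SUP m. \<Sum>k. ennreal ((cmod (taylor_coeff h k))\<^sup>2) * M k m)"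
    unfolding M_def using nn_integral_smaller_disc_norm_square[OF hol r] by simp
  also have "\<dots> = (\<Sum>k. SUP m. ennreal ((cmod (taylor_coeff h k))\<^sup>2) * M k m)"
    by (rule ennreal_suminf_SUP_eq[symmetric]) (auto intro!: incseq_SucI mult_left_mono incseq_SucD[OF inc])
  also have "\<dots> = (\<Sum>k. ennreal ((cmod (taylor_coeff h k))\<^sup>2) * (SUP m. M k m))"
    by (simp add: SUP_mult_left_ennreal)
  also have "\<dots> = (\<Sum>k. ennreal (pi * fact k * fact n / fact (k + n + 1) * (cmod (taylor_coeff h k))\<^sup>2))"
    unfolding M by (subst ennreal_mult[symmetric]) (auto simp: mult.commute)
  finally show ?thesis .
qed

subsection \<open>Weighted means of sequences\<close>

text \<open>The usual inequality applied to \<open>sqrt (v i)\<close> and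
  \<open>sqrt (v i) * x i\<close>.\<close>

lemma weighted_Cauchy_Schwarz:
  fixes v x :: "'a \<Rightarrow> real"
  assumes "\<And>i. i \<in> A \<Longrightarrow> 0 \<le> v i"
  shows "(\<Sum>i\<in>A. v i * x i)\<^sup>2 \<le> (\<Sum>i\<in>A. v i) * (\<Sum>i\<in>A. v i * (x i)\<^sup>2)"
proof -
  have "(\<Sum>i\<in>A. v i * x i) = (\<Sum>i\<in>A. sqrt (v i) * (sqrt (v i) * x i))"
    using assms by (intro sum.cong) (auto simp: mult.assoc[symmetric])
  moreover have "(\<Sum>i\<in>A. v i) = (\<Sum>i\<in>A. (sqrt (v i))\<^sup>2)"
    using assms by (intro sum.cong) auto
  moreover have "(\<Sum>i\<in>A. v i * (x i)\<^sup>2) = (\<Sum>i\<in>A. (sqrt (v i) * x i)\<^sup>2)"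
    using assms by (intro sum.cong) (auto simp: power_mult_distrib)
  ultimately show ?thesis
    using Cauchy_Schwarz_ineq_sum[of "\<lambda>i. sqrt (v i)" "\<lambda>i. sqrt (v i) * x i" A] by simp
qed

text \<open>Second moment equals variance plus squared mean, for points \<open>a\<close> and
  \<open>b\<close> with weights \<open>q\<close> and \<open>p\<close>. The identity is checked for
  real numbers and then added up over real and imaginary parts.\<close>

lemma variance_two_points:
  fixes a b :: complex and p q :: real
  assumes "0 < p" "0 < q"
  shows "q * (cmod a)\<^sup>2 + p * (cmod b)\<^sup>2 = p * q / (p + q) * (cmod (a - b))\<^sup>2 +
     (p + q) * (cmod ((of_real p * b + of_real q * a) / of_real (p + q)))\<^sup>2"
proof -
  have real: "q * x\<^sup>2 + p * y\<^sup>2 = p * q / (p + q) * (x - y)\<^sup>2 + (p + q) * ((p * y + q * x) / (p + q))\<^sup>2" for x y :: real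
  proof -
    have "(p + q) * (q * x\<^sup>2 + p * y\<^sup>2) = p * q * (x - y)\<^sup>2 + (p * y + q * x)\<^sup>2"
      by (simp add: power2_eq_square algebra_simps)
    then have "q * x\<^sup>2 + p * y\<^sup>2 = (p * q * (x - y)\<^sup>2 + (p * y + q * x)\<^sup>2) / (p + q)"
      using assms by (simp add: eq_divide_eq mult.commute)
    also have "\<dots> = p * q / (p + q) * (x - y)\<^sup>2 + (p + q) * ((p * y + q * x) / (p + q))\<^sup>2"
    proof -
      have "(p + q) * ((p * y + q * x) / (p + q))\<^sup>2 = (p * y + q * x)\<^sup>2 / (p + q)"
        using assms by (simp only: power_divide) (simp add: power2_eq_square[of "p + q"])
      then show ?thesis by (simp add: add_divide_distrib)
    qed
    finally show ?thesis .
  qed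
  have "cmod ((of_real p * b + of_real q * a) / of_real (p + q)) ^ 2 =
      ((p * Re b + q * Re a) / (p + q))\<^sup>2 + ((p * Im b + q * Im a) / (p + q))\<^sup>2"
    by (simp add: cmod_power2 Re_divide_of_real Im_divide_of_real del: of_real_add)
  then show ?thesis
    using real[of "Re a" "Re b"] real[of "Im a" "Im b"]
    by (simp add: cmod_power2 distrib_left)
qed

definition total_weight :: "(nat \<Rightarrow> real) \<Rightarrow> nat \<Rightarrow> real" where
  "total_weight w k = (\<Sum>j\<le>k. w j)"

definition weighted_mean :: "(nat \<Rightarrow> real) \<Rightarrow> (nat \<Rightarrow> complex) \<Rightarrow> nat \<Rightarrow> complex" where
  "weighted_mean w u k = (\<Sum>j\<le>k. of_real (w j) * u j) / of_real (total_weight w k)"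

text \<open>The growth of the weighted sum of squared deviations from the mean when
  \<open>u (Suc k)\<close> joins \<open>u 0, ..., u k\<close>.\<close>

definition mean_increment :: "(nat \<Rightarrow> real) \<Rightarrow> (nat \<Rightarrow> complex) \<Rightarrow> nat \<Rightarrow> real" where
  "mean_increment w u k = total_weight w k * w (Suc k) / total_weight w (Suc k) *
     (cmod (u (Suc k) - weighted_mean w u k))\<^sup>2"

context
  fixes w :: "nat \<Rightarrow> real"
  assumes w_pos: "\<And>k. 0 < w k"
begin

lemma total_weight_pos: "0 < total_weight w k"
  unfolding total_weight_def using w_pos by (intro sum_pos) auto

lemma total_weight_Suc: "total_weight w (Suc k) = total_weight w k + w (Suc k)"
  by (simp add: total_weight_def)

lemma weighted_mean_Suc:
  "weighted_mean w u (Suc k) =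
    (of_real (total_weight w k) * weighted_mean w u k + of_real (w (Suc k)) * u (Suc k)) /
    of_real (total_weight w (Suc k))"
  using total_weight_pos[of k] by (simp add: weighted_mean_def)

lemma mean_increment_nonneg: "0 \<le> mean_increment w u k"
  unfolding mean_increment_def using total_weight_pos w_pos
  by (intro mult_nonneg_nonneg divide_nonneg_nonneg) (auto intro: less_imp_le)

text \<open>In the induction step, \<open>variance_two_points\<close> is applied to the new point
  and to the old mean, which carries the total weight of all earlier points.\<close>

lemma sum_weighted_norm_square:
  "(\<Sum>k\<le>K. w k * (cmod (u k))\<^sup>2) =
    (\<Sum>k<K. mean_increment w u k) + total_weight w K * (cmod (weighted_mean w u K))\<^sup>2"
proof (induction K)
  case 0
  show ?case using w_pos[of 0] by (simp add: weighted_mean_def total_weight_def norm_mult norm_divide)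
next
  case (Suc K)
  have "(\<Sum>k\<le>Suc K. w k * (cmod (u k))\<^sup>2) = (\<Sum>k<K. mean_increment w u k) +
      (w (Suc K) * (cmod (u (Suc K)))\<^sup>2 + total_weight w K * (cmod (weighted_mean w u K))\<^sup>2)"
    using Suc.IH by simp
  also have "\<dots> = (\<Sum>k<Suc K. mean_increment w u k) + total_weight w (Suc K) * (cmod (weighted_mean w u (Suc K)))\<^sup>2"
    unfolding weighted_mean_Suc total_weight_Suc
    by (subst variance_two_points[OF total_weight_pos w_pos]) (simp add: mean_increment_def total_weight_Suc)
  finally show ?case .
qed

text \<open>The weighted sum is split at a fixed index \<open>M\<close>. The head is constant while
  the total weight grows without bound; by Cauchy-Schwarz the squared tail is at most the total
  weight times a small tail of the convergent series.\<close>

lemma weighted_mean_tendsto_0: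
  assumes W: "filterlim (total_weight w) at_top sequentially"
    and u: "summable (\<lambda>k. w k * (cmod (u k))\<^sup>2)"
  shows "(\<lambda>K. total_weight w K * (cmod (weighted_mean w u K))\<^sup>2) \<longlonglongrightarrow> 0"
proof (rule LIMSEQ_I)
  fix e :: real assume e: "0 < e"
  define d where "d k = w k * (cmod (u k))\<^sup>2" for k
  have d0: "0 \<le> d k" for k unfolding d_def using w_pos[of k] by simp
  \<comment> \<open>With \<open>e / 4\<close> here and the bound \<open>4 * A\<^sup>2 / e\<close> on
    the total weight below, head and tail each account for at most half of \<open>W * e\<close> in
    \<open>2 * A\<^sup>2 + 2 * Bt\<^sup>2\<close>.\<close>
  obtain M where M: "\<forall>m\<ge>M. \<forall>n. norm (sum d {m..<n}) < e / 4"
    using u e unfolding d_def[symmetric] summable_Cauchy by (meson zero_less_divide_iff zero_less_numeral)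
  have M: "sum d {M..<K} < e / 4" for K
    using M[rule_format, of M K] by simp
  define A where "A = cmod (\<Sum>j<M. of_real (w j) * u j)"
  have "eventually (\<lambda>K. 4 * A\<^sup>2 / e < total_weight w K \<and> M \<le> K) sequentially"
    using filterlim_at_top_dense[THEN iffD1, OF W] by (intro eventually_conj eventually_ge_at_top) auto
  then obtain N where N: "\<And>K. N \<le> K \<Longrightarrow> 4 * A\<^sup>2 / e < total_weight w K \<and> M \<le> K"
    unfolding eventually_sequentially by blast
  show "\<exists>N. \<forall>K\<ge>N. norm (total_weight w K * (cmod (weighted_mean w u K))\<^sup>2 - 0) < e"
  proof (intro exI allI impI)
    fix K assume "N \<le> K"
    define W where "W = total_weight w K"
    have W: "0 < W" "4 * A\<^sup>2 / e < W" and MK: "M \<le> K"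
      using N[OF \<open>N \<le> K\<close>] total_weight_pos by (auto simp: W_def)
    define Bt where "Bt = (\<Sum>j\<in>{M..<Suc K}. w j * cmod (u j))"
    have "Bt\<^sup>2 \<le> (\<Sum>j\<in>{M..<Suc K}. w j) * (\<Sum>j\<in>{M..<Suc K}. d j)"
      unfolding Bt_def d_def using w_pos by (intro weighted_Cauchy_Schwarz) (auto intro: less_imp_le)
    also have "\<dots> \<le> W * (e / 4)"
    proof (intro mult_mono)
      show "(\<Sum>j\<in>{M..<Suc K}. w j) \<le> W"
        unfolding W_def total_weight_def using w_pos by (intro sum_mono2) (auto intro: less_imp_le)
      show "sum d {M..<Suc K} \<le> e / 4" using M[of "Suc K"] by simp
    qed (use d0 W in \<open>simp_all only: sum_nonneg less_imp_le\<close>)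
    finally have B: "Bt\<^sup>2 \<le> W * (e / 4)" .
    have "(\<Sum>j\<le>K. of_real (w j) * u j) = (\<Sum>j<M. of_real (w j) * u j) + (\<Sum>j\<in>{M..<Suc K}. of_real (w j) * u j)"
      using MK by (subst sum.union_disjoint[symmetric]) (auto intro!: sum.cong)
    then have "cmod (\<Sum>j\<le>K. of_real (w j) * u j) \<le> A + cmod (\<Sum>j\<in>{M..<Suc K}. of_real (w j) * u j)"
      unfolding A_def by (simp only: norm_triangle_ineq)
    also have "cmod (\<Sum>j\<in>{M..<Suc K}. of_real (w j) * u j) \<le> Bt"
      unfolding Bt_def using w_pos by (intro sum_norm_le) (auto simp: norm_mult abs_of_pos)
    finally have "(cmod (\<Sum>j\<le>K. of_real (w j) * u j))\<^sup>2 \<le> (A + Bt)\<^sup>2"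
      by (intro power_mono) auto
    also have "\<dots> \<le> 2 * A\<^sup>2 + 2 * Bt\<^sup>2"
      using sum_squares_bound[of A Bt] by (simp add: power2_sum)
    also have "\<dots> < W * e"
    proof -
      have "4 * A\<^sup>2 < W * e" using W(2) e by (simp add: field_simps)
      then show ?thesis using B by simp
    qed
    finally have S: "(cmod (\<Sum>j\<le>K. of_real (w j) * u j))\<^sup>2 < W * e" .
    have "W * (cmod (weighted_mean w u K))\<^sup>2 = (cmod (\<Sum>j\<le>K. of_real (w j) * u j))\<^sup>2 / W"
      using W by (simp add: weighted_mean_def W_def[symmetric] norm_divide power_divide power2_eq_square)
    also have "\<dots> < e" using S W by (simp add: field_simps)
    finally show "norm (total_weight w K * (cmod (weighted_mean w u K))\<^sup>2 - 0) < e"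
      using W by (simp add: W_def)
  qed
qed

text \<open>Let \<open>K\<close> tend to infinity in \<open>sum_weighted_norm_square\<close>; the
  term with the mean vanishes.\<close>

lemma mean_increment_sums:
  assumes W: "filterlim (total_weight w) at_top sequentially"
    and u: "summable (\<lambda>k. w k * (cmod (u k))\<^sup>2)"
  shows "mean_increment w u sums (\<Sum>k. w k * (cmod (u k))\<^sup>2)"
proof -
  have "(\<lambda>K. (\<Sum>k\<le>K. w k * (cmod (u k))\<^sup>2) - total_weight w K * (cmod (weighted_mean w u K))\<^sup>2)
      \<longlonglongrightarrow> (\<Sum>k. w k * (cmod (u k))\<^sup>2) - 0"
    by (intro tendsto_diff summable_LIMSEQ' u weighted_mean_tendsto_0 W)
  then show ?thesis
    unfolding sums_def sum_weighted_norm_square by simp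
qed

text \<open>Each step of the mean is \<open>v k * x k\<close>, and Cauchy-Schwarz separates the
  telescoping weights from the increments. The bound yields convergence of the means together with
  its rate.\<close>

lemma weighted_mean_diff_bound:
  assumes E: "summable (mean_increment w u)" and "K \<le> N"
  shows "(cmod (weighted_mean w u N - weighted_mean w u K))\<^sup>2 \<le> (\<Sum>k. mean_increment w u k) / total_weight w K"
proof -
  define W where "W = total_weight w"
  define T where "T = weighted_mean w u"
  \<comment> \<open>These weights telescope, and \<open>v k * (x k)\<^sup>2\<close> is the mean increment.\<close>
  define v where "v k = w (Suc k) / (W k * W (Suc k))" for k
  define x where "x k = W k * cmod (u (Suc k) - T k)" for k
  have W: "0 < W k" for k using total_weight_pos by (simp add: W_def)
  have v_eq: "v k = 1 / W k - 1 / W (Suc k)" for k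
    using W[of k] W[of "Suc k"] by (simp add: v_def field_simps) (simp add: W_def total_weight_Suc)
  have v0: "0 \<le> v k" for k
    unfolding v_def using W[of k] W[of "Suc k"] w_pos[of "Suc k"] by simp
  have diff: "cmod (T (Suc k) - T k) = v k * x k" for k
  proof -
    have "T (Suc k) - T k = of_real (w (Suc k) / W (Suc k)) * (u (Suc k) - T k)"
      using W[of "Suc k"] unfolding T_def weighted_mean_Suc W_def[symmetric]
      by (simp add: field_simps) (simp add: W_def total_weight_Suc algebra_simps)
    then show ?thesis
      using W[of k] W[of "Suc k"] w_pos[of "Suc k"]
      by (simp add: norm_mult norm_divide v_def x_def)
  qed
  have vx: "v k * (x k)\<^sup>2 = mean_increment w u k" for k
    using W[of k] by (simp add: v_def x_def mean_increment_def W_def[symmetric] T_def[symmetric] power2_eq_square)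
  have "cmod (T N - T K) = cmod (\<Sum>k\<in>{K..<N}. T (Suc k) - T k)"
    using \<open>K \<le> N\<close> by (simp add: sum_Suc_diff')
  also have "\<dots> \<le> (\<Sum>k\<in>{K..<N}. v k * x k)"
    by (intro sum_norm_le) (simp add: diff)
  finally have "(cmod (T N - T K))\<^sup>2 \<le> (\<Sum>k\<in>{K..<N}. v k * x k)\<^sup>2"
    by (intro power_mono) auto
  also have "\<dots> \<le> (\<Sum>k\<in>{K..<N}. v k) * (\<Sum>k\<in>{K..<N}. mean_increment w u k)"
    unfolding vx[symmetric] by (intro weighted_Cauchy_Schwarz v0)
  also have "\<dots> \<le> (1 / W K) * (\<Sum>k. mean_increment w u k)"
  proof (intro mult_mono)
    have "(\<Sum>k\<in>{K..<N}. v k) = - (\<Sum>k\<in>{K..<N}. 1 / W (Suc k) - 1 / W k)"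
      by (simp add: v_eq sum_negf[symmetric])
    also have "\<dots> = 1 / W K - 1 / W N"
      using \<open>K \<le> N\<close> by (subst sum_Suc_diff') auto
    also have "\<dots> \<le> 1 / W K" using W[of N] by simp
    finally show "(\<Sum>k\<in>{K..<N}. v k) \<le> 1 / W K" .
  qed (use W[of K] E mean_increment_nonneg in \<open>auto intro!: sum_le_suminf sum_nonneg\<close>)
  finally show ?thesis by (simp add: T_def W_def)
qed

lemma weighted_mean_diff_const: "weighted_mean w (\<lambda>k. u k - L) K = weighted_mean w u K - L"
proof -
  have "(\<Sum>j\<le>K. of_real (w j) * (u j - L)) = (\<Sum>j\<le>K. of_real (w j) * u j) - of_real (total_weight w K) * L"
    by (simp add: total_weight_def right_diff_distrib sum_subtractf sum_distrib_right)
  then show ?thesis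
    using total_weight_pos[of K] by (simp add: weighted_mean_def diff_divide_distrib)
qed

lemma mean_increment_diff_const: "mean_increment w (\<lambda>k. u k - L) = mean_increment w u"
  by (simp add: fun_eq_iff mean_increment_def weighted_mean_diff_const)

text \<open>\<open>L\<close> is the limit of the means. Subtracting it leaves the increments
  unchanged, and the rate of convergence keeps the mean term in
  \<open>sum_weighted_norm_square\<close> bounded.\<close>

lemma summable_diff_const_of_mean_increment:
  assumes W: "filterlim (total_weight w) at_top sequentially"
    and E: "summable (mean_increment w u)"
  obtains L where "summable (\<lambda>k. w k * (cmod (u k - L))\<^sup>2)"
proof -
  define C where "C = (\<Sum>k. mean_increment w u k)"
  note bnd = weighted_mean_diff_bound[OF E, folded C_def]
  have "Cauchy (weighted_mean w u)"
  proof (rule metric_CauchyI)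
    fix e :: real assume e: "0 < e"
    \<comment> \<open>Chosen so that \<open>C / total_weight w M\<close> is less than
      \<open>(e / 2)\<^sup>2\<close>.\<close>
    have "eventually (\<lambda>K. 4 * C / e\<^sup>2 < total_weight w K) sequentially"
      using filterlim_at_top_dense[THEN iffD1, OF W] by (rule spec)
    then obtain M where M: "4 * C / e\<^sup>2 < total_weight w M"
      using eventually_happens'[OF sequentially_bot] by blast
    have half: "dist (weighted_mean w u N) (weighted_mean w u M) < e / 2" if "M \<le> N" for N
    proof -
      have "(cmod (weighted_mean w u N - weighted_mean w u M))\<^sup>2 \<le> C / total_weight w M"
        using bnd that .
      also have "\<dots> < (e / 2)\<^sup>2"
      proof -
        have "4 * C < total_weight w M * e\<^sup>2" using M e by (simp add: pos_divide_less_eq)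
        then show ?thesis using total_weight_pos[of M] by (simp add: pos_divide_less_eq power_divide mult.commute)
      qed
      finally have "cmod (weighted_mean w u N - weighted_mean w u M) < e / 2"
        by (rule power2_less_imp_less) (use e in simp)
      then show ?thesis unfolding dist_norm .
    qed
    show "\<exists>M. \<forall>m\<ge>M. \<forall>n\<ge>M. dist (weighted_mean w u m) (weighted_mean w u n) < e"
      using dist_triangle_half_l[OF half half] by (intro exI[of _ M]) simp
  qed
  then obtain L where L: "weighted_mean w u \<longlonglongrightarrow> L"
    using Cauchy_convergent_iff convergent_def by blast
  have lim: "total_weight w K * (cmod (weighted_mean w u K - L))\<^sup>2 \<le> C" for K
  proof -
    \<comment> \<open>The bound on differences of means is passed to the limit in \<open>N\<close>
      with \<open>K\<close> fixed.\<close>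
    have "(\<lambda>N. (cmod (weighted_mean w u N - weighted_mean w u K))\<^sup>2) \<longlonglongrightarrow> (cmod (L - weighted_mean w u K))\<^sup>2"
      by (intro tendsto_intros L)
    then have "(cmod (L - weighted_mean w u K))\<^sup>2 \<le> C / total_weight w K"
      by (rule tendsto_upperbound) (auto simp: eventually_sequentially intro!: exI[of _ K] bnd)
    then show ?thesis
      using total_weight_pos[of K] by (simp add: field_simps norm_minus_commute)
  qed
  have "summable (\<lambda>k. w k * (cmod (u k - L))\<^sup>2)"
  proof (rule bounded_imp_summable)
    fix K
    have "(\<Sum>k\<le>K. w k * (cmod (u k - L))\<^sup>2) =
        (\<Sum>k<K. mean_increment w u k) + total_weight w K * (cmod (weighted_mean w u K - L))\<^sup>2"
      using sum_weighted_norm_square[of "\<lambda>k. u k - L" K]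
      by (simp add: mean_increment_diff_const weighted_mean_diff_const)
    also have "\<dots> \<le> C + C"
      unfolding C_def[symmetric] using lim E mean_increment_nonneg
      by (intro add_mono lim) (auto simp: C_def intro!: sum_le_suminf)
    finally show "(\<Sum>k\<le>K. w k * (cmod (u k - L))\<^sup>2) \<le> C + C" .
  qed (use w_pos in \<open>simp add: less_imp_le\<close>)
  then show ?thesis by (rule that)
qed

text \<open>Abel summation: the differences of \<open>u\<close> weighted by total weights add up to
  the last total weight times \<open>u (Suc k)\<close> minus the weighted sum, which is the
  deviation of \<open>u (Suc k)\<close> from the mean.\<close>

lemma summation_by_parts_weighted_mean:
  assumes H0: "H 0 = c * of_real (total_weight w 0) * (u 1 - u 0)"
    and HS: "\<And>k. H (Suc k) - H k = c * of_real (total_weight w (Suc k)) * (u (Suc (Suc k)) - u (Suc k))"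
  shows "H k = c * of_real (total_weight w k) * (u (Suc k) - weighted_mean w u k)"
proof -
  have "H k = c * (of_real (total_weight w k) * u (Suc k) - (\<Sum>j\<le>k. of_real (w j) * u j))"
  proof (induction k)
    case 0
    then show ?case by (simp add: H0 total_weight_def algebra_simps)
  next
    case (Suc k)
    have "H (Suc k) = H k + c * of_real (total_weight w (Suc k)) * (u (Suc (Suc k)) - u (Suc k))"
      using HS[of k] by (simp add: algebra_simps)
    then show ?case
      by (simp add: Suc.IH total_weight_Suc algebra_simps)
  qed
  then show ?thesis
    using total_weight_pos[of k] by (simp add: weighted_mean_def algebra_simps)
qed

end

subsection \<open>The higher order local Dirichlet integral\<close>

text \<open>The weight of the coefficient with index \<open>k + p\<close> in
  \<open>D_sigma p\<close>. The shift skips the zero weights below \<open>p\<close>, so that all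
  weights are positive.\<close>

definition choose_weight :: "nat \<Rightarrow> nat \<Rightarrow> real" where
  "choose_weight p k = real ((k + p) choose p)"

lemma choose_weight_pos: "0 < choose_weight p k"
  by (simp add: choose_weight_def)

lemma choose_weight_fact: "choose_weight p k = fact (k + p) / (fact p * fact k)"
  by (simp add: choose_weight_def binomial_fact)

text \<open>The hockey-stick identity: total weights of order \<open>p\<close> are the weights of
  order \<open>Suc p\<close>.\<close>

lemma total_choose_weight: "total_weight (choose_weight p) k = choose_weight (Suc p) k"
proof -
  have "(\<Sum>j\<le>k. (j + p) choose p) = (k + Suc p) choose Suc p"
    using choose_rising_sum(1)[of p k] by (simp add: ac_simps)
  then show ?thesis
    unfolding total_weight_def choose_weight_def by (simp only: of_nat_sum[symmetric])
qed

text \<open>Every weight is at least \<open>1\<close>, so the total weight dominates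
  \<open>k\<close>.\<close>

lemma filterlim_total_choose_weight: "filterlim (total_weight (choose_weight p)) at_top sequentially"
proof (rule filterlim_at_top_mono[OF filterlim_real_sequentially])
  show "eventually (\<lambda>k. real k \<le> total_weight (choose_weight p) k) sequentially"
  proof (rule always_eventually, rule allI)
    fix k
    have "real k \<le> (\<Sum>j\<le>k. 1)" by simp
    also have "\<dots> \<le> total_weight (choose_weight p) k"
      unfolding total_weight_def choose_weight_def
      by (intro sum_mono) (simp only: real_of_nat_ge_one_iff, simp add: Suc_le_eq)
    finally show "real k \<le> total_weight (choose_weight p) k" .
  qed
qed

lemma D_sigma_eq_shifted:
  "D_sigma p g = (\<Sum>k. ennreal (choose_weight p k * (cmod (taylor_coeff g (k + p)))\<^sup>2))"
proof -
  define F where "F k = ennreal (real (k choose p) * (cmod (taylor_coeff g k))\<^sup>2)" for k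
  have "D_sigma p g = (\<Sum>k. F k)" by (simp add: D_sigma_def F_def)
  also have "\<dots> = (\<Sum>k. F (k + p)) + (\<Sum>k<p. F k)"
    by (rule suminf_offset) simp
  also have "(\<Sum>k<p. F k) = 0" by (rule sum.neutral) (simp add: F_def)
  finally show ?thesis by (simp add: F_def choose_weight_def)
qed

section \<open>Taylor coefficients of derivatives and of products with a linear factor\<close>

lemma taylor_coeff_higher_deriv:
  "taylor_coeff ((deriv ^^ n) f) k = fact (k + n) / fact k * taylor_coeff f (k + n)"
  by (simp add: taylor_coeff_def funpow_add)

text \<open>Comparison of coefficients of formal power series. It serves both for \<open>f\<close>
  in terms of \<open>g\<close> and, with constant \<open>0\<close>, for the derivative of
  \<open>f\<close> in terms of its quotient by \<open>z - lam\<close>.\<close>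

lemma taylor_coeff_linear_mult:
  assumes g: "g holomorphic_on ball 0 1"
    and F: "\<And>z. z \<in> ball 0 1 \<Longrightarrow> F z = \<alpha> + (z - lam) * g z"
  shows "taylor_coeff F 0 = \<alpha> - lam * taylor_coeff g 0"
    and "taylor_coeff F (Suc k) = taylor_coeff g k - lam * taylor_coeff g (Suc k)"
proof -
  define G where "G = fps_expansion g 0"
  have tc: "taylor_coeff f j = fps_nth (fps_expansion f 0) j" for f j
    by (simp add: taylor_coeff_def fps_expansion_def)
  have "g has_fps_expansion G"
    unfolding G_def using g by (intro has_fps_expansion_fps_expansion[of "ball 0 1"]) auto
  then have "(\<lambda>z. \<alpha> + (z - lam) * g z) has_fps_expansion fps_const \<alpha> + (fps_X - fps_const lam) * G"
    by (intro fps_expansion_intros)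
  moreover have "eventually (\<lambda>z. F z = \<alpha> + (z - lam) * g z) (nhds 0)"
    using F by (intro eventually_nhds_in_open[of "ball 0 1", THEN eventually_mono]) auto
  ultimately have "F has_fps_expansion fps_const \<alpha> + (fps_X - fps_const lam) * G"
    by (subst has_fps_expansion_cong[OF _ refl])
  then have "fps_expansion F 0 = fps_const \<alpha> + (fps_X - fps_const lam) * G"
    by (rule fps_expansion_eqI)
  then show "taylor_coeff F 0 = \<alpha> - lam * taylor_coeff g 0"
    and "taylor_coeff F (Suc k) = taylor_coeff g k - lam * taylor_coeff g (Suc k)"
    unfolding tc G_def[symmetric] by (simp_all add: left_diff_distrib)
qed

section \<open>The coefficient formula and the decomposition\<close>

text \<open>Parseval expresses the integral by the coefficients of \<open>h\<close>, and summation
  by parts expresses these by deviations from weighted means. The identity holds in the extended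
  reals, so it also serves when finiteness of \<open>D_sigma p g\<close> is not yet known.\<close>

lemma D_lambda_eq_mean_increment:
  fixes g :: "complex \<Rightarrow> complex" and p :: nat
  assumes lam: "cmod lam = 1" and f: "f holomorphic_on ball 0 1" and g: "g holomorphic_on ball 0 1"
    and fg: "\<And>z. z \<in> ball 0 1 \<Longrightarrow> f z = \<alpha> + (z - lam) * g z"
  defines "u \<equiv> \<lambda>k. lam ^ k * taylor_coeff g (k + p)"
  shows "D_lambda lam (Suc p) f = (\<Sum>k. ennreal (mean_increment (choose_weight p) u k))"
proof -
  define n where "n = Suc p"
  define W where "W = total_weight (choose_weight p)"
  define T where "T = weighted_mean (choose_weight p) u"
  define h where "h z = (deriv ^^ n) f z / (z - lam)" for z
  \<comment> \<open>The factor of modulus one turns the two-term recursion for the coefficients of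
    \<open>h\<close> into a plain difference \<open>H (Suc k) - H k\<close>.\<close>
  define H where "H k = lam ^ Suc k * taylor_coeff h k" for k
  have W: "W k = fact (k + n) / (fact n * fact k)" for k
    unfolding W_def total_choose_weight choose_weight_fact n_def ..
  have lam0: "lam \<noteq> 0" "z \<noteq> lam" if "z \<in> ball 0 1" for z
    using lam that by auto
  have hol_fn: "(deriv ^^ n) f holomorphic_on ball 0 1"
    using f by (intro holomorphic_higher_deriv) auto
  have hol_h: "h holomorphic_on ball 0 1"
    unfolding h_def using lam0 by (intro holomorphic_intros hol_fn) auto
  have fn: "(deriv ^^ n) f z = 0 + (z - lam) * h z" if "z \<in> ball 0 1" for z
    using lam0[OF that] by (simp add: h_def)
  have f_coeff: "taylor_coeff f (Suc k) = taylor_coeff g k - lam * taylor_coeff g (Suc k)" for k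
    by (rule taylor_coeff_linear_mult(2)[OF g fg])
  have H: "H k = fact n * of_real (W k) * (u (Suc k) - T k)" for k
    unfolding W_def T_def
  proof (rule summation_by_parts_weighted_mean[OF choose_weight_pos])
    have "fact n * taylor_coeff f n = - (lam * taylor_coeff h 0)"
      using taylor_coeff_linear_mult(1)[OF hol_h fn] by (simp add: taylor_coeff_higher_deriv)
    then show "H 0 = fact n * of_real (total_weight (choose_weight p) 0) * (u 1 - u 0)"
      by (simp add: H_def u_def W[unfolded W_def] n_def f_coeff algebra_simps del: fact_Suc)
  next
    fix k
    have "fact (Suc k + n) / fact (Suc k) * taylor_coeff f (Suc k + n) = taylor_coeff h k - lam * taylor_coeff h (Suc k)"
      using taylor_coeff_linear_mult(2)[OF hol_h fn, of k] by (simp only: taylor_coeff_higher_deriv)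
    also have "fact (Suc k + n) / fact (Suc k) = (fact n * of_real (W (Suc k)) :: complex)"
      by (simp add: W del: fact_Suc)
    also have "taylor_coeff f (Suc k + n) = taylor_coeff g (Suc k + p) - lam * taylor_coeff g (Suc (Suc k) + p)"
      using f_coeff[of "Suc k + p"] by (simp add: n_def)
    finally have "lam ^ Suc k * (taylor_coeff h k - lam * taylor_coeff h (Suc k)) =
        lam ^ Suc k * (fact n * of_real (W (Suc k)) * (taylor_coeff g (Suc k + p) - lam * taylor_coeff g (Suc (Suc k) + p)))"
      by simp
    then show "H (Suc k) - H k = fact n * of_real (total_weight (choose_weight p) (Suc k)) * (u (Suc (Suc k)) - u (Suc k))"
      unfolding W_def[symmetric] H_def u_def by (simp add: algebra_simps del: fact_Suc)
  qed
  \<comment> \<open>Normalising constant, disc moment and squared coefficient combine to exactly one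
    mean increment.\<close>
  have term_eq: "1 / (fact n * fact p * pi) * (pi * fact k * fact n / fact (k + n + 1) * (cmod (taylor_coeff h k))\<^sup>2)
      = mean_increment (choose_weight p) u k" for k
  proof -
    have "cmod (taylor_coeff h k) = cmod (H k)"
      by (simp add: H_def norm_mult norm_power lam)
    also have "\<dots> = fact n * W k * cmod (u (Suc k) - T k)"
      unfolding H using total_weight_pos[of "choose_weight p" k, OF choose_weight_pos]
      by (simp add: norm_mult W_def del: fact_Suc)
    finally have "1 / (fact n * fact p * pi) * (pi * fact k * fact n / fact (k + n + 1) * (cmod (taylor_coeff h k))\<^sup>2)
       = fact k * (fact n)\<^sup>2 * (W k)\<^sup>2 / (fact p * fact (k + n + 1)) * (cmod (u (Suc k) - T k))\<^sup>2"
      by (simp add: power_mult_distrib del: fact_Suc)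
    also have "fact k * (fact n)\<^sup>2 * (W k)\<^sup>2 / (fact p * fact (k + n + 1)) = W k * choose_weight p (Suc k) / W (Suc k)"
    proof -
      have "k + n = Suc k + p" by (simp add: n_def)
      then show ?thesis
        unfolding W choose_weight_fact
        by (simp add: power2_eq_square field_simps del: fact_Suc)
    qed
    finally show ?thesis by (simp add: mean_increment_def W_def T_def)
  qed
  have "D_lambda lam (Suc p) f = ennreal (1 / (fact n * fact p * pi)) *
     (\<integral>\<^sup>+ z \<in> ball 0 1. ennreal ((cmod (h z))\<^sup>2 * (1 - (cmod z)\<^sup>2) ^ n) \<partial>lborel)"
  proof -
    have "n - 1 = p" by (simp add: n_def)
    \<comment> \<open>The Poisson kernel supplies the denominator of \<open>h\<close> and one more
      factor \<open>1 - (cmod z)\<^sup>2\<close>, which raises the exponent from \<open>p\<close> to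
      \<open>n\<close>.\<close>
    moreover have "(\<integral>\<^sup>+ z \<in> ball 0 1. ennreal ((cmod ((deriv ^^ n) f z))\<^sup>2 * poisson_dirac lam z * (1 - (cmod z)\<^sup>2) ^ p) \<partial>lborel) =
       (\<integral>\<^sup>+ z \<in> ball 0 1. ennreal ((cmod (h z))\<^sup>2 * (1 - (cmod z)\<^sup>2) ^ n) \<partial>lborel)"
      by (intro nn_integral_cong)
         (simp add: poisson_dirac_def h_def norm_divide power_divide n_def mult.assoc)
    ultimately show ?thesis by (simp only: D_lambda_def n_def[symmetric])
  qed
  also have "\<dots> = (\<Sum>k. ennreal (1 / (fact n * fact p * pi)) *
      ennreal (pi * fact k * fact n / fact (k + n + 1) * (cmod (taylor_coeff h k))\<^sup>2))"
    unfolding nn_integral_disc_norm_square[OF hol_h] by simp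
  also have "\<dots> = (\<Sum>k. ennreal (mean_increment (choose_weight p) u k))"
    unfolding term_eq[symmetric] by (intro suminf_cong ennreal_mult[symmetric]) auto
  finally show ?thesis .
qed

text \<open>Since \<open>lam\<close> has modulus one, \<open>D_sigma p g\<close> is the weighted
  square sum of \<open>u\<close>. When it is finite, the mean increments have the same sum.\<close>

lemma D_lambda_eq_D_sigma:
  assumes lam: "cmod lam = 1" and f: "f holomorphic_on ball 0 1" and g: "g holomorphic_on ball 0 1"
    and fg: "\<And>z. z \<in> ball 0 1 \<Longrightarrow> f z = \<alpha> + (z - lam) * g z"
    and fin: "D_sigma p g < \<infinity>"
  shows "D_lambda lam (Suc p) f = D_sigma p g"
proof -
  define u where "u = (\<lambda>k. lam ^ k * taylor_coeff g (k + p))"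
  have ds: "D_sigma p g = (\<Sum>k. ennreal (choose_weight p k * (cmod (u k))\<^sup>2))"
    by (simp add: D_sigma_eq_shifted u_def norm_mult norm_power lam)
  have nn: "0 \<le> choose_weight p k * (cmod (u k))\<^sup>2" for k
    using choose_weight_pos[of p k] by simp
  have sm: "summable (\<lambda>k. choose_weight p k * (cmod (u k))\<^sup>2)"
    using fin nn unfolding ds by (intro summable_suminf_not_top) auto
  have "D_lambda lam (Suc p) f = (\<Sum>k. ennreal (mean_increment (choose_weight p) u k))"
    unfolding u_def by (rule D_lambda_eq_mean_increment[OF lam f g fg])
  also have "\<dots> = ennreal (\<Sum>k. choose_weight p k * (cmod (u k))\<^sup>2)"
    by (intro suminf_ennreal_eq mean_increment_nonneg choose_weight_pos mean_increment_sums filterlim_total_choose_weight sm)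
  also have "\<dots> = D_sigma p g"
    unfolding ds using nn sm by (intro suminf_ennreal2[symmetric])
  finally show ?thesis .
qed

text \<open>The quotient with \<open>\<alpha> = 0\<close> is holomorphic because \<open>lam\<close>
  lies on the boundary. Its mean increments are summable, which produces the constant
  \<open>L\<close> to be removed from \<open>u\<close>; the right \<open>\<alpha>\<close> does
  this.\<close>

lemma finite_D_lambda_imp_decomposition:
  assumes lam: "cmod lam = 1" and f: "f holomorphic_on ball 0 1" and fin: "D_lambda lam (Suc p) f < \<infinity>"
  obtains \<alpha> g where "g holomorphic_on ball 0 1" "D_sigma p g < \<infinity>"
    "\<And>z. z \<in> ball 0 1 \<Longrightarrow> f z = \<alpha> + (z - lam) * g z"
proof -
  have lam0: "lam \<noteq> 0" using lam by auto
  have zlam: "z \<noteq> lam" if "z \<in> ball 0 1" for z using lam that by auto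
  define q where "q \<alpha> z = (f z - \<alpha>) / (z - lam)" for \<alpha> z
  have q_hol: "q \<alpha> holomorphic_on ball 0 1" for \<alpha>
    unfolding q_def using zlam by (intro holomorphic_intros f) auto
  have q: "f z = \<alpha> + (z - lam) * q \<alpha> z" if "z \<in> ball 0 1" for z \<alpha>
    using zlam[OF that] by (simp add: q_def)
  define u where "u = (\<lambda>k. lam ^ k * taylor_coeff (q 0) (k + p))"
  have "D_lambda lam (Suc p) f = (\<Sum>k. ennreal (mean_increment (choose_weight p) u k))"
    unfolding u_def by (rule D_lambda_eq_mean_increment[OF lam f q_hol q])
  then have "summable (mean_increment (choose_weight p) u)"
    using fin by (intro summable_suminf_not_top mean_increment_nonneg choose_weight_pos) auto
  then obtain L where L: "summable (\<lambda>k. choose_weight p k * (cmod (u k - L))\<^sup>2)"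
    using summable_diff_const_of_mean_increment[OF choose_weight_pos filterlim_total_choose_weight] by blast
  \<comment> \<open>Changing \<open>\<alpha>\<close> adds a multiple of \<open>1 / (z - lam)\<close> to the quotient, hence a constant to \<open>u\<close>.\<close>
  define \<alpha> where "\<alpha> = - L * lam ^ Suc p"
  \<comment> \<open>The difference of the two quotients is \<open>\<alpha> / (lam - z)\<close>, and
    these are its geometric series coefficients.\<close>
  have e: "lam ^ Suc k * (taylor_coeff (q \<alpha>) k - taylor_coeff (q 0) k) = \<alpha>" for k
  proof (induction k)
    case 0
    show ?case
      using taylor_coeff_linear_mult(1)[OF q_hol q, of \<alpha>] taylor_coeff_linear_mult(1)[OF q_hol q, of 0]
      by (simp add: algebra_simps)
  next
    case (Suc k)
    have "lam * (taylor_coeff (q \<alpha>) (Suc k) - taylor_coeff (q 0) (Suc k)) = taylor_coeff (q \<alpha>) k - taylor_coeff (q 0) k"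
      using taylor_coeff_linear_mult(2)[OF q_hol q, of k \<alpha>] taylor_coeff_linear_mult(2)[OF q_hol q, of k 0]
      by algebra
    then show ?case using Suc.IH by (simp only: power_Suc2[of lam "Suc k"] mult.assoc)
  qed
  have "lam ^ k * taylor_coeff (q \<alpha>) (k + p) = u k - L" for k
  proof -
    \<comment> \<open>The power of \<open>lam\<close> in \<open>\<alpha>\<close> compensates the
      index shift by \<open>p\<close>.\<close>
    have "lam ^ Suc p * (lam ^ k * (taylor_coeff (q \<alpha>) (k + p) - taylor_coeff (q 0) (k + p))) = lam ^ Suc p * (- L)"
      using e[of "k + p"] by (simp add: \<alpha>_def power_add algebra_simps)
    then have "lam ^ k * (taylor_coeff (q \<alpha>) (k + p) - taylor_coeff (q 0) (k + p)) = - L"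
      using lam0 by (subst (asm) mult_cancel_left) auto
    then show ?thesis by (simp add: u_def algebra_simps)
  qed
  then have "cmod (taylor_coeff (q \<alpha>) (k + p)) = cmod (u k - L)" for k
    by (metis lam mult_1 norm_mult norm_power power_one)
  then have "D_sigma p (q \<alpha>) = ennreal (\<Sum>k. choose_weight p k * (cmod (u k - L))\<^sup>2)"
    unfolding D_sigma_eq_shifted using choose_weight_pos[of p] L
    by (simp add: suminf_ennreal2 less_imp_le)
  then show ?thesis using q_hol q by (intro that[of "q \<alpha>" \<alpha>]) auto
qed

section \<open>Growth of Hardy space functions and boundary limits\<close>

text \<open>The power series is split at \<open>M\<close>. The head is bounded by \<open>A\<close>,
  so the factor \<open>1 - (cmod z)\<^sup>2\<close> makes it small near the circle; for the tail,
  Cauchy-Schwarz with the geometric series cancels that factor against a small tail of the square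
  sum.\<close>

lemma hardy_growth:
  assumes g: "g holomorphic_on ball 0 1" and sm: "summable (\<lambda>k. (cmod (taylor_coeff g k))\<^sup>2)" and "0 < e"
  obtains d where "0 < d" "\<And>z. \<lbrakk>z \<in> ball 0 1; 1 - d < cmod z\<rbrakk> \<Longrightarrow> (1 - (cmod z)\<^sup>2) * (cmod (g z))\<^sup>2 < e"
proof -
  define a where "a k = cmod (taylor_coeff g k)" for k
  obtain M where M: "\<forall>m\<ge>M. \<forall>n. norm (\<Sum>k\<in>{m..<n}. (a k)\<^sup>2) < e / 8"
    using sm \<open>0 < e\<close> unfolding a_def summable_Cauchy by (meson zero_less_divide_iff zero_less_numeral)
  define A where "A = (\<Sum>k<M. a k)"
  \<comment> \<open>Since \<open>y \<le> 2 * d\<close>, the head \<open>2 * A\<^sup>2 * y\<close> is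
    at most \<open>e / 2\<close>, and the tail adds \<open>e / 4\<close>. The summand
    \<open>1\<close> keeps the denominator positive.\<close>
  define d where "d = e / (8 * (A\<^sup>2 + 1))"
  have d0: "0 < d" unfolding d_def using \<open>0 < e\<close> by (simp add: add_nonneg_pos)
  have "(1 - (cmod z)\<^sup>2) * (cmod (g z))\<^sup>2 < e" if z: "z \<in> ball 0 1" "1 - d < cmod z" for z
  proof -
    define r where "r = cmod z"
    have r: "0 \<le> r" "r < 1" "1 - d < r" using z by (auto simp: r_def)
    define y where "y = 1 - r\<^sup>2"
    have y: "0 < y" using r by (simp add: y_def abs_square_less_1)
    have y_le: "y \<le> 2 * d"
    proof -
      have "y = (1 - r) * (1 + r)" by (simp add: y_def power2_eq_square algebra_simps)
      also have "\<dots> \<le> d * 2" using r d0 by (intro mult_mono) auto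
      finally show ?thesis by simp
    qed
    have part: "y * (cmod (\<Sum>k<N. taylor_coeff g k * z ^ k))\<^sup>2 \<le> 2 * A\<^sup>2 * y + e / 4" if "M \<le> N" for N
    proof -
      define B where "B = (\<Sum>k\<in>{M..<N}. a k * r ^ k)"
      have "cmod (\<Sum>k<N. taylor_coeff g k * z ^ k) \<le> (\<Sum>k<N. a k * r ^ k)"
        by (rule sum_norm_le) (simp add: a_def r_def norm_mult norm_power)
      also have "\<dots> = (\<Sum>k<M. a k * r ^ k) + B"
        unfolding B_def using that by (subst sum.union_disjoint[symmetric]) (auto intro!: sum.cong)
      also have "(\<Sum>k<M. a k * r ^ k) \<le> (\<Sum>k<M. a k * 1)"
        using r by (intro sum_mono mult_left_mono power_le_one) (auto simp: a_def)
      finally have "cmod (\<Sum>k<N. taylor_coeff g k * z ^ k) \<le> A + B" by (simp add: A_def)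
      then have "(cmod (\<Sum>k<N. taylor_coeff g k * z ^ k))\<^sup>2 \<le> (A + B)\<^sup>2"
        by (intro power_mono) auto
      also have "\<dots> \<le> 2 * A\<^sup>2 + 2 * B\<^sup>2"
        using sum_squares_bound[of A B] by (simp add: power2_sum)
      finally have 1: "y * (cmod (\<Sum>k<N. taylor_coeff g k * z ^ k))\<^sup>2 \<le> y * (2 * A\<^sup>2 + 2 * B\<^sup>2)"
        using y by (intro mult_left_mono) auto
      have "B\<^sup>2 \<le> (\<Sum>k\<in>{M..<N}. (a k)\<^sup>2) * (\<Sum>k\<in>{M..<N}. (r ^ k)\<^sup>2)"
        unfolding B_def by (rule Cauchy_Schwarz_ineq_sum)
      also have "\<dots> \<le> (e / 8) * (1 / y)"
      proof (intro mult_mono)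
        show "(\<Sum>k\<in>{M..<N}. (a k)\<^sup>2) \<le> e / 8" using M[rule_format, of M N] by simp
        have "(\<lambda>k. (r\<^sup>2) ^ k) sums (1 / (1 - r\<^sup>2))"
          using y by (intro geometric_sums) (simp add: y_def)
        then have "(\<Sum>k\<in>{M..<N}. (r\<^sup>2) ^ k) \<le> 1 / y"
          unfolding y_def by (subst sums_unique, assumption) (intro sum_le_suminf; auto simp: sums_iff)
        then show "(\<Sum>k\<in>{M..<N}. (r ^ k)\<^sup>2) \<le> 1 / y"
          by (simp add: power_mult[symmetric] mult.commute)
      qed (use \<open>0 < e\<close> in \<open>auto intro: sum_nonneg\<close>)
      finally have "y * B\<^sup>2 \<le> e / 8" using y by (simp add: field_simps)
      then show ?thesis using 1 by (simp add: algebra_simps)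
    qed
    have "(\<lambda>N. y * (cmod (\<Sum>k<N. taylor_coeff g k * z ^ k))\<^sup>2) \<longlonglongrightarrow> y * (cmod (g z))\<^sup>2"
      using holomorphic_taylor_sums[OF g z(1)] unfolding sums_def by (intro tendsto_intros)
    then have "y * (cmod (g z))\<^sup>2 \<le> 2 * A\<^sup>2 * y + e / 4"
      by (rule tendsto_upperbound) (auto simp: eventually_sequentially intro!: exI[of _ M] part)
    also have "\<dots> \<le> 2 * A\<^sup>2 * (2 * d) + e / 4"
      using y_le by (intro add_mono mult_left_mono) auto
    also have "\<dots> < e"
    proof -
      have "A\<^sup>2 * d \<le> (A\<^sup>2 + 1) * d" using d0 by (intro mult_right_mono) auto
      also have "\<dots> = e / 8"
      proof -
        have "A\<^sup>2 + 1 \<noteq> 0" by (smt (verit) zero_le_power2)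
        moreover have "x * (e / (8 * x)) = e / 8" if "x \<noteq> 0" for x using that by simp
        ultimately show ?thesis unfolding d_def by blast
      qed
      finally show ?thesis using \<open>0 < e\<close> by simp
    qed
    finally show ?thesis by (simp add: y_def r_def)
  qed
  then show ?thesis using d0 that by blast
qed

text \<open>The weights are at least \<open>1\<close> from index \<open>p\<close> on, and finitely
  many coefficients do not affect summability.\<close>

lemma summable_coeff_of_D_sigma:
  assumes "D_sigma p g < \<infinity>"
  shows "summable (\<lambda>k. (cmod (taylor_coeff g k))\<^sup>2)"
proof -
  have nn: "0 \<le> choose_weight p k * (cmod (taylor_coeff g (k + p)))\<^sup>2" for k
    using choose_weight_pos[of p k] by simp
  have "summable (\<lambda>k. choose_weight p k * (cmod (taylor_coeff g (k + p)))\<^sup>2)"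
    using assms nn unfolding D_sigma_eq_shifted by (intro summable_suminf_not_top) auto
  then have "summable (\<lambda>k. (cmod (taylor_coeff g (k + p)))\<^sup>2)"
  proof (rule summable_comparison_test'[where N = 0])
    fix k
    have "(1::nat) \<le> (k + p) choose p" by (simp add: Suc_le_eq)
    then have "1 \<le> choose_weight p k" unfolding choose_weight_def by (simp only: real_of_nat_ge_one_iff)
    then show "norm ((cmod (taylor_coeff g (k + p)))\<^sup>2) \<le> choose_weight p k * (cmod (taylor_coeff g (k + p)))\<^sup>2"
      using mult_right_mono[of 1 "choose_weight p k" "(cmod (taylor_coeff g (k + p)))\<^sup>2"] by simp
  qed
  then show ?thesis
    using summable_iff_shift[of "\<lambda>k. (cmod (taylor_coeff g k))\<^sup>2" p] by blast
qed

text \<open>In the region, \<open>cmod (f z - \<alpha>)\<close> is at most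
  \<open>\<kappa> * sqrt (1 - (cmod z)\<^sup>2) * cmod (g z)\<close>, which is small by
  \<open>hardy_growth\<close> applied with \<open>(e / \<kappa>)\<^sup>2\<close>. Closeness to
  \<open>lam\<close> forces \<open>cmod z\<close> to be close to \<open>1\<close>.\<close>

lemma oricyclic_limit:
  assumes g: "g holomorphic_on ball 0 1" and fin: "D_sigma p g < \<infinity>"
    and fg: "\<And>z. z \<in> ball 0 1 \<Longrightarrow> f z = \<alpha> + (z - lam) * g z" and lam: "cmod lam = 1" and "0 < \<kappa>"
  shows "(f \<longlongrightarrow> \<alpha>) (at lam within {z \<in> ball 0 1. cmod (z - lam) < \<kappa> * sqrt (1 - (cmod z)\<^sup>2)})"
  unfolding Lim_within
proof (intro allI impI)
  fix e :: real assume "0 < e"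
  then have "0 < (e / \<kappa>)\<^sup>2" using \<open>0 < \<kappa>\<close> by simp
  then obtain d where d: "0 < d" "\<And>z. \<lbrakk>z \<in> ball 0 1; 1 - d < cmod z\<rbrakk> \<Longrightarrow> (1 - (cmod z)\<^sup>2) * (cmod (g z))\<^sup>2 < (e / \<kappa>)\<^sup>2"
    using hardy_growth[OF g summable_coeff_of_D_sigma[OF fin]] by blast
  have "dist (f z) \<alpha> < e"
    if z: "z \<in> ball 0 1" "cmod (z - lam) < \<kappa> * sqrt (1 - (cmod z)\<^sup>2)" and zd: "dist z lam < d" for z
  proof -
    have "1 - d < cmod z"
      using zd lam norm_triangle_ineq2[of lam z] by (simp add: dist_norm norm_minus_commute)
    then have "(1 - (cmod z)\<^sup>2) * (cmod (g z))\<^sup>2 < (e / \<kappa>)\<^sup>2" using d z by blast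
    then have "sqrt ((1 - (cmod z)\<^sup>2) * (cmod (g z))\<^sup>2) < e / \<kappa>"
      using \<open>0 < e\<close> \<open>0 < \<kappa>\<close> by (intro real_less_lsqrt) auto
    then have 1: "\<kappa> * (sqrt (1 - (cmod z)\<^sup>2) * cmod (g z)) < e"
      using \<open>0 < \<kappa>\<close> by (simp add: real_sqrt_mult pos_less_divide_eq mult.commute)
    have "dist (f z) \<alpha> = cmod (z - lam) * cmod (g z)"
      using fg[OF z(1)] by (simp add: dist_norm norm_mult)
    also have "\<dots> \<le> \<kappa> * sqrt (1 - (cmod z)\<^sup>2) * cmod (g z)"
      using z by (intro mult_right_mono) auto
    finally show ?thesis using 1 by simp
  qed
  then show "\<exists>d>0. \<forall>x\<in>{z \<in> ball 0 1. cmod (z - lam) < \<kappa> * sqrt (1 - (cmod z)\<^sup>2)}.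
      0 < dist x lam \<and> dist x lam < d \<longrightarrow> dist (f x) \<alpha> < e"
    using d(1) by blast
qed

text \<open>On the radius \<open>1 - r \<le> sqrt (1 - r\<^sup>2)\<close>, so the aperture
  \<open>2\<close> leaves room for the strict inequality.\<close>

lemma filterlim_radius_oricyclic:
  assumes lam: "cmod lam = 1"
  shows "filterlim (\<lambda>r. complex_of_real r * lam)
     (at lam within {z \<in> ball 0 1. cmod (z - lam) < 2 * sqrt (1 - (cmod z)\<^sup>2)}) (at_left 1)"
  unfolding filterlim_at
proof
  have "((\<lambda>r. complex_of_real r * lam) \<longlongrightarrow> complex_of_real 1 * lam) (at_left 1)"
    by (intro tendsto_intros)
  then show "((\<lambda>r. complex_of_real r * lam) \<longlongrightarrow> lam) (at_left 1)" by simp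
  show "\<forall>\<^sub>F r in at_left 1. complex_of_real r * lam \<in> {z \<in> ball 0 1. cmod (z - lam) < 2 * sqrt (1 - (cmod z)\<^sup>2)}
      \<and> complex_of_real r * lam \<noteq> lam"
  proof (rule eventually_at_leftI[of 0])
    fix r :: real assume r: "r \<in> {0<..<1}"
    have n: "cmod (complex_of_real r * lam) = r" using r lam by (simp add: norm_mult)
    have "complex_of_real r * lam - lam = complex_of_real (r - 1) * lam" by (simp add: algebra_simps)
    then have diff: "cmod (complex_of_real r * lam - lam) = 1 - r"
      using r lam by (simp only: norm_mult norm_of_real) simp
    have pos: "0 < 1 - r\<^sup>2" using r by (simp add: abs_square_less_1)
    have "(1 - r)\<^sup>2 \<le> 1 - r\<^sup>2"
    proof -
      have "1 - r\<^sup>2 - (1 - r)\<^sup>2 = 2 * (r * (1 - r))" by (simp add: power2_eq_square algebra_simps)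
      also have "0 \<le> \<dots>" using r by simp
      finally show ?thesis by simp
    qed
    then have "1 - r \<le> sqrt (1 - r\<^sup>2)" by (rule real_le_rsqrt)
    also have "\<dots> < 2 * sqrt (1 - r\<^sup>2)" using pos by simp
    finally show "complex_of_real r * lam \<in> {z \<in> ball 0 1. cmod (z - lam) < 2 * sqrt (1 - (cmod z)\<^sup>2)}
      \<and> complex_of_real r * lam \<noteq> lam"
      using r n diff by auto
  qed simp
qed

section \<open>Assembly of the equivalence, the norm identity and the boundary limits\<close>

theorem theorem1p1:
  fixes n :: nat and lam :: complex and f :: "complex \<Rightarrow> complex"
  assumes "n \<ge> 1" and "cmod lam = 1" and "f holomorphic_on ball 0 1"
  shows "(D_lambda lam n f < \<infinity> \<longleftrightarrow>
           (\<exists>\<alpha> g. g holomorphic_on ball 0 1 \<and> D_sigma (n - 1) g < \<infinity> \<and>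
                  (\<forall>z\<in>ball 0 1. f z = \<alpha> + (z - lam) * g z)))
       \<and> (\<forall>\<alpha> g. g holomorphic_on ball 0 1 \<and> D_sigma (n - 1) g < \<infinity> \<and>
                  (\<forall>z\<in>ball 0 1. f z = \<alpha> + (z - lam) * g z) \<longrightarrow>
              D_lambda lam n f = D_sigma (n - 1) g
            \<and> (\<forall>\<kappa>>0. (f \<longlongrightarrow> \<alpha>)
                  (at lam within {z \<in> ball 0 1. cmod (z - lam) < \<kappa> * sqrt (1 - (cmod z)\<^sup>2)}))
            \<and> ((\<lambda>r. f (complex_of_real r * lam)) \<longlongrightarrow> \<alpha>) (at_left 1))"
proof -
  obtain p where n: "n = Suc p" using assms(1) by (cases n) auto
  have eq: "D_lambda lam n f = D_sigma (n - 1) g"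
    if "g holomorphic_on ball 0 1" "D_sigma (n - 1) g < \<infinity>" "\<forall>z\<in>ball 0 1. f z = \<alpha> + (z - lam) * g z" for \<alpha> g
    using that D_lambda_eq_D_sigma[OF assms(2,3), of g \<alpha> p] by (simp add: n)
  have ex: "\<exists>\<alpha> g. g holomorphic_on ball 0 1 \<and> D_sigma (n - 1) g < \<infinity> \<and> (\<forall>z\<in>ball 0 1. f z = \<alpha> + (z - lam) * g z)"
    if "D_lambda lam n f < \<infinity>"
    using finite_D_lambda_imp_decomposition[OF assms(2,3), of p] that unfolding n diff_Suc_1 by metis
  have lim: "(f \<longlongrightarrow> \<alpha>) (at lam within {z \<in> ball 0 1. cmod (z - lam) < \<kappa> * sqrt (1 - (cmod z)\<^sup>2)})"
    if "g holomorphic_on ball 0 1" "D_sigma (n - 1) g < \<infinity>" "\<forall>z\<in>ball 0 1. f z = \<alpha> + (z - lam) * g z" "0 < \<kappa>" for \<alpha> g \<kappa>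
    using that by (intro oricyclic_limit[of g "n - 1" f \<alpha> lam \<kappa>] assms(2)) auto
  have rad: "((\<lambda>r. f (complex_of_real r * lam)) \<longlongrightarrow> \<alpha>) (at_left 1)"
    if "g holomorphic_on ball 0 1" "D_sigma (n - 1) g < \<infinity>" "\<forall>z\<in>ball 0 1. f z = \<alpha> + (z - lam) * g z" for \<alpha> g
    \<comment> \<open>The radial limit is the oricyclic limit with \<open>\<kappa> = 2\<close> taken
      along the radius.\<close>
    using filterlim_compose[OF lim[OF that, of 2] filterlim_radius_oricyclic[OF assms(2)]] by simp
  have fin: "D_lambda lam n f < \<infinity>"
    if "\<exists>\<alpha> g. g holomorphic_on ball 0 1 \<and> D_sigma (n - 1) g < \<infinity> \<and> (\<forall>z\<in>ball 0 1. f z = \<alpha> + (z - lam) * g z)"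
  proof -
    from that obtain \<alpha> g where g: "g holomorphic_on ball 0 1" "D_sigma (n - 1) g < \<infinity>" "\<forall>z\<in>ball 0 1. f z = \<alpha> + (z - lam) * g z"
      by blast
    show ?thesis unfolding eq[OF g] by (rule g(2))
  qed
  show ?thesis
    by (intro conjI iffI allI impI; (elim conjE)?; (rule ex fin eq lim rad; assumption))
qed

end
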